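(* For any $\epsilon>0$, there is a randomized algorithm that, given access to an $n$-vertex simple graph $G$ in the adjacency matrix query model, with probability $1-1/\mathrm{poly}(n)$ reports a $(2,\epsilon n)$-approximation to the size $\mu(G)$ of a maximum matching and a $(2,\epsilon n)$-approximation to the size $\nu(G)$ of a minimum vertex cover, using $\widetilde O(n/\epsilon^3)$ time and queries.
   Context: Adjacency matrix query model: the vertex set is known (say $[n]$) and the algorithm may query, for any pair $(u,v)$ of vertices, whether $u$ and $v$ are adjacent. For $\alpha\ge1$ and $0\le\epsilon\le1$, estimates $\widetilde\mu,\widetilde\nu$ are $(\alpha,\epsilon n)$-approximations of $\mu(G),\nu(G)$ if $\mu(G)/\alpha-\epsilon n\le\widetilde\mu\le\mu(G)$ and $\nu(G)\le\widetilde\nu\le\alpha\nu(G)+\epsilon n$. $\widetilde O(\cdot)$ hides $\mathrm{poly}\log n$ factors. *)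

theory Defs
  imports
    "HOL-Probability.Probability"
    "HOL-Library.Disjoint_Sets"
    "HOL-Library.Discrete_Functions"
begin

section \<open>Graphs, matchings, vertex covers\<close>

text \<open>A simple graph on the vertex set \<open>{0,\<dots>,n-1}\<close> is given by its set of edges.\<close>

definition simple_graph :: "nat \<Rightarrow> nat set set \<Rightarrow> bool" where
  "simple_graph n E \<longleftrightarrow> (\<forall>e\<in>E. \<exists>u v. u < n \<and> v < n \<and> u \<noteq> v \<and> e = {u, v})"

definition is_matching :: "nat set set \<Rightarrow> nat set set \<Rightarrow> bool" where
  "is_matching E M \<longleftrightarrow> M \<subseteq> E \<and> disjoint M"

definition is_vertex_cover :: "nat \<Rightarrow> nat set set \<Rightarrow> nat set \<Rightarrow> bool" where
  "is_vertex_cover n E C \<longleftrightarrow> C \<subseteq> {..<n} \<and> (\<forall>e\<in>E. e \<inter> C \<noteq> {})"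

definition max_matching_size :: "nat set set \<Rightarrow> nat" where
  "max_matching_size E = Max (card ` {M. is_matching E M})"

definition min_vertex_cover_size :: "nat \<Rightarrow> nat set set \<Rightarrow> nat" where
  "min_vertex_cover_size n E = Min (card ` {C. is_vertex_cover n E C})"

definition approx_matching_size ::
    "real \<Rightarrow> real \<Rightarrow> nat set set \<Rightarrow> real \<Rightarrow> bool" where
  "approx_matching_size \<alpha> \<delta> E x \<longleftrightarrow>
     real (max_matching_size E) / \<alpha> - \<delta> \<le> x \<and> x \<le> real (max_matching_size E)"

definition approx_vertex_cover_size ::
    "real \<Rightarrow> real \<Rightarrow> nat \<Rightarrow> nat set set \<Rightarrow> real \<Rightarrow> bool" where
  "approx_vertex_cover_size \<alpha> \<delta> n E x \<longleftrightarrow>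
     real (min_vertex_cover_size n E) \<le> x \<and> x \<le> \<alpha> * real (min_vertex_cover_size n E) + \<delta>"


section \<open>Randomized algorithms in the adjacency matrix query model\<close>

text \<open>
  Algorithms are structured programs of a randomized random access machine with logarithmic
  cost: the memory consists of arrays of natural numbers (all entries are initially 0, apart
  from the input), and every operation is charged the bit lengths of its operands. Up to factors
  polylogarithmic in the numbers involved this is the time of a word RAM, without any
  restriction on the word length having to be imposed.
\<close>

type_synonym memory = "nat \<Rightarrow> nat \<Rightarrow> nat"

datatype binop = Plus | Minus | Times | Divide | Less

datatype expr =
    Const nat
  | Read nat expr \<comment> \<open>array name, index\<close>
  | Bin binop expr expr

datatype com =
    Skip
  | Assign nat expr expr       \<comment> \<open>array, index, value\<close>
  | Sample nat expr expr       \<comment> \<open>array, index, size of the range\<close>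
  | Query nat expr expr expr   \<comment> \<open>array, index, the two vertices\<close>
  | Seq com com
  | If expr com com
  | While expr com

definition bits :: "nat \<Rightarrow> nat" where
  "bits k = Suc (floor_log k)"

fun apply_op :: "binop \<Rightarrow> nat \<Rightarrow> nat \<Rightarrow> nat" where
  "apply_op Plus x y = x + y"
| "apply_op Minus x y = x - y"
| "apply_op Times x y = x * y"
| "apply_op Divide x y = x div y"
| "apply_op Less x y = (if x < y then 1 else 0)"

fun eval_expr :: "memory \<Rightarrow> expr \<Rightarrow> nat" where
  "eval_expr m (Const k) = k"
| "eval_expr m (Read a i) = m a (eval_expr m i)"
| "eval_expr m (Bin f d e) = apply_op f (eval_expr m d) (eval_expr m e)"

fun cost_expr :: "memory \<Rightarrow> expr \<Rightarrow> nat" where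
  "cost_expr m (Const k) = bits k"
| "cost_expr m (Read a i) =
     cost_expr m i + bits (eval_expr m i) + bits (m a (eval_expr m i))"
| "cost_expr m (Bin f d e) =
     cost_expr m d + cost_expr m e + bits (eval_expr m d) + bits (eval_expr m e)"

definition store :: "memory \<Rightarrow> nat \<Rightarrow> nat \<Rightarrow> nat \<Rightarrow> memory" where
  "store m a i x = m(a := (m a)(i := x))"

text \<open>
  A configuration holds the commands still to be executed, the memory, the time spent and the
  number of queries made so far.
\<close>

datatype config =
  Config (todo: "com list") (mem: memory) (time_used: nat) (queries_used: nat)

text \<open>
  The graph enters only through \<^const>\<open>Query\<close>. Each step of a configuration that has not halted
  takes at least one unit of time; halted configurations do not change.
  A sample from an empty range yields 0.
\<close>

fun step :: "nat set set \<Rightarrow> config \<Rightarrow> config pmf" where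
  "step E (Config [] m t q) = return_pmf (Config [] m t q)"
| "step E (Config (Skip # cs) m t q) = return_pmf (Config cs m (t + 1) q)"
| "step E (Config (Assign a i e # cs) m t q) =
     (let j = eval_expr m i; x = eval_expr m e
      in return_pmf (Config cs (store m a j x)
           (t + cost_expr m i + cost_expr m e + bits j + bits x) q))"
| "step E (Config (Sample a i e # cs) m t q) =
     (let j = eval_expr m i; k = eval_expr m e
      in map_pmf (\<lambda>x. Config cs (store m a j x)
           (t + cost_expr m i + cost_expr m e + bits j + bits k) q)
         (pmf_of_set {..<max 1 k}))"
| "step E (Config (Query a i d e # cs) m t q) =
     (let j = eval_expr m i; u = eval_expr m d; v = eval_expr m e
      in return_pmf (Config cs (store m a j (if {u, v} \<in> E then 1 else 0))
           (t + cost_expr m i + cost_expr m d + cost_expr m e + bits j + bits u + bits v)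
           (q + 1)))"
| "step E (Config (Seq c c' # cs) m t q) = return_pmf (Config (c # c' # cs) m (t + 1) q)"
| "step E (Config (If b c c' # cs) m t q) =
     return_pmf (Config ((if eval_expr m b \<noteq> 0 then c else c') # cs) m
       (t + cost_expr m b + 1) q)"
| "step E (Config (While b c # cs) m t q) =
     return_pmf (Config (if eval_expr m b \<noteq> 0 then c # While b c # cs else cs) m
       (t + cost_expr m b + 1) q)"

fun steps :: "nat set set \<Rightarrow> nat \<Rightarrow> config \<Rightarrow> config pmf" where
  "steps E 0 c = return_pmf c"
| "steps E (Suc l) c = bind_pmf (step E c) (steps E l)"

text \<open>
  The input is the number of vertices, in entry 0 of array 0. The outputs are entry 0 of array 1
  and entry 0 of array 2. Integral outputs are no restriction here, as the quantities
  to be estimated are natural numbers: an admissible estimate of the matching size can be rounded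
  up (negative ones to 0), one of the vertex cover size can be rounded down.
\<close>

definition initial :: "com \<Rightarrow> nat \<Rightarrow> config" where
  "initial P n = Config [P] (store (\<lambda>_ _. 0) 0 0 n) 0 0"

definition halted :: "config \<Rightarrow> bool" where
  "halted c \<longleftrightarrow> todo c = []"

definition matching_output :: "config \<Rightarrow> nat" where
  "matching_output c = mem c 1 0"

definition vertex_cover_output :: "config \<Rightarrow> nat" where
  "vertex_cover_output c = mem c 2 0"

end

(* Run the greedy matching algorithm on the n perfect matchings {u, v} with u + v = c (mod n), taken in
   a uniformly random order s of the classes c. A vertex is matched by round t iff in some round i < t
   it is still free, is adjacent to its partner, and the partner is free in round i as well; evaluating
   this recursion with an explicit stack tells whether one given vertex is matched. The stacks that occur
   are paths with decreasing rounds whose vertices are all free in their rounds. Shifting the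
   classes cyclically along such a path is injective: from the shifted order, the last vertex and
   the largest round the path can be read off backwards, since at the first place where two candidates
   differ the common vertex would already have been matched in the earlier of the two rounds. Hence at
   most n! n^2 pairs of an order and a path exist, i.e. the exploration from a random vertex in a random
   order takes O(n) steps on average. Cutting it off after O(n / eps) steps loses a fraction O(eps)
   of the matched vertices, and O(log n / eps^2) independent explorations estimate the fraction of
   matched vertices. The matched vertices number twice a maximal matching and form a vertex cover. *)
theory Submission
  imports Defs "HOL-Combinatorics.Cycles"
begin

section \<open>Greedy matching in a random order of the rounds\<close>

text \<open>The classes stand in for a random order of all pairs. An adjacency matrix offers no list
  of neighbours, so an exploration must scan the possible partners of a vertex by increasing rank.
  Here the partner in a given round is found by arithmetic and decided by one query, and a whole
  order is a permutation of \<open>n\<close> numbers, cheap enough to be redrawn for every trial.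
  Each pair of distinct vertices lies in exactly one class and the pairs of a class are disjoint, so
  ties of rank are harmless. The price is that the ranks of different pairs are strongly dependent.
  The counting argument copes with this because it uses only that the order is a bijection and that
  each class is an involution. It counts queries and not merely recursive calls: the pair examined
  by the top entry of a stack need not be an edge, so every unsuccessful query has a stack of its
  own.\<close>

definition partner :: "nat \<Rightarrow> nat \<Rightarrow> nat \<Rightarrow> nat" where
  "partner n c u = (c + n - u) mod n"

lemma partner_less: "0 < n \<Longrightarrow> partner n c u < n"
  by (simp add: partner_def)

lemma partner_eq:
  assumes "c < n" "u < n"
  shows "partner n c u = (if u \<le> c then c - u else c + n - u)"
proof (cases "u \<le> c")
  case True
  then have "c + n - u = (c - u) + n" by simp
  then have "partner n c u = (c - u) mod n"
    unfolding partner_def by (metis mod_add_self2)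
  then show ?thesis using True assms by simp
next
  case False
  then show ?thesis using assms by (simp add: partner_def)
qed

text \<open>This is what makes a class a matching: it splits the vertices into disjoint pairs and
  fixed points. A fixed point \<open>u\<close> leads to the set \<open>{u}\<close>, which is no edge
  of a simple graph.\<close>

lemma partner_partner:
  assumes "c < n" "u < n"
  shows "partner n c (partner n c u) = u"
  using partner_less[of n c u] assms by (auto simp: partner_eq)

lemma ex_partner:
  assumes "u < n" "w < n"
  shows "\<exists>c<n. partner n c u = w"
proof (cases "u + w < n")
  case True
  then show ?thesis using assms by (intro exI[of _ "u + w"]) (simp add: partner_eq)
next
  case False
  then show ?thesis using assms by (intro exI[of _ "u + w - n"]) (auto simp: partner_eq)
qed

context
  fixes n :: nat and E :: "nat set set"
begin

primrec matched :: "(nat \<Rightarrow> nat) \<Rightarrow> nat \<Rightarrow> nat set" where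
  "matched s 0 = {}"
| "matched s (Suc t) = matched s t \<union>
     {u. u < n \<and> u \<notin> matched s t \<and> partner n (s t) u \<notin> matched s t \<and> {u, partner n (s t) u} \<in> E}"

lemma matched_mono: "t \<le> t' \<Longrightarrow> matched s t \<subseteq> matched s t'"
  by (induction t' rule: dec_induct) auto

lemma matched_subset: "matched s t \<subseteq> {..<n}"
  by (induction t) auto

lemma matched_cong: "(\<And>i. i < t \<Longrightarrow> s i = s' i) \<Longrightarrow> matched s t = matched s' t"
  by (induction t) auto

section \<open>Stacks of the exploration as paths with monotone rounds\<close>

fun limit :: "(nat \<times> nat) list \<Rightarrow> nat" where
  "limit [] = n"
| "limit ((b, y) # st) = y"

text \<open>
  A stack lists pairs of a vertex and the round in which its partner is examined, the top first; the
  partner of an entry in its round is the vertex above it. The top entry may have reached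
  its limit, which means that its vertex is free until the round of the entry below.
\<close>

fun wf_stack :: "(nat \<Rightarrow> nat) \<Rightarrow> (nat \<times> nat) list \<Rightarrow> bool" where
  "wf_stack s [] \<longleftrightarrow> True"
| "wf_stack s ((a, x) # st) \<longleftrightarrow> a < n \<and> x \<le> limit st \<and> a \<notin> matched s x \<and> wf_stack s st \<and>
     (case st of [] \<Rightarrow> True
      | (b, y) # st' \<Rightarrow> y < limit st' \<and> a = partner n (s y) b \<and> {a, b} \<in> E)"

definition active :: "(nat \<times> nat) list \<Rightarrow> bool" where
  "active st \<longleftrightarrow> st \<noteq> [] \<and> snd (hd st) < limit (tl st)"

text \<open>Indexed form of the recursive invariant. Activity supplies the strict inequality at the
  top, where \<open>wf_stack\<close> itself has only a weak one; this makes the rounds distinct, so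
  that they can be permuted by a cycle.\<close>

lemma wf_stackD:
  assumes "wf_stack s st" "active st"
  shows "sorted_wrt (<) (map snd st) \<and> set (map snd st) \<subseteq> {..<n} \<and>
    (\<forall>i<length st. fst (st ! i) < n \<and> fst (st ! i) \<notin> matched s (snd (st ! i))) \<and>
    (\<forall>i. Suc i < length st \<longrightarrow>
      fst (st ! i) = partner n (s (snd (st ! Suc i))) (fst (st ! Suc i)) \<and>
      {fst (st ! i), fst (st ! Suc i)} \<in> E)"
  using assms
proof (induction st)
  case Nil
  then show ?case by (simp add: active_def)
next
  case (Cons p st)
  obtain a x where p: "p = (a, x)" by force
  show ?case
  proof (cases st)
    case Nil
    then show ?thesis using Cons.prems by (auto simp: p active_def)
  next
    case (Cons q st')
    obtain b y where q: "q = (b, y)" by force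
    have act: "active st" "x < y" "wf_stack s st"
      using Cons.prems by (auto simp: p q Cons active_def)
    note IH = Cons.IH[OF act(3,1)]
    have "sorted_wrt (<) (map snd (p # st))"
      using IH act(2) by (auto simp: p q Cons)
    moreover have "set (map snd (p # st)) \<subseteq> {..<n}"
      using IH act(2) by (auto simp: p q Cons)
    moreover have "\<forall>i<length (p # st). fst ((p # st) ! i) < n \<and>
        fst ((p # st) ! i) \<notin> matched s (snd ((p # st) ! i))"
      using IH Cons.prems by (auto simp: p nth_Cons split: nat.split)
    moreover have "\<forall>i. Suc i < length (p # st) \<longrightarrow>
        fst ((p # st) ! i) = partner n (s (snd ((p # st) ! Suc i))) (fst ((p # st) ! Suc i)) \<and>
        {fst ((p # st) ! i), fst ((p # st) ! Suc i)} \<in> E"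
      using IH Cons.prems by (auto simp: p q Cons nth_Cons split: nat.split)
    ultimately show ?thesis by blast
  qed
qed

section \<open>Injectivity of the cyclic shift\<close>

definition rotated :: "(nat \<Rightarrow> nat) \<Rightarrow> (nat \<times> nat) list \<Rightarrow> nat \<Rightarrow> nat" where
  "rotated s st = s \<circ> cycle_of_list (map snd st)"

lemma rotated_permutes:
  assumes "s permutes {..<n}" "wf_stack s st" "active st"
  shows "rotated s st permutes {..<n}"
  unfolding rotated_def
  using permutes_compose[OF permutes_subset[OF cycle_permutes] assms(1)] wf_stackD[OF assms(2,3)]
  by blast

text \<open>In \<open>s\<close> the round of an entry holds the class leading to the vertex above
  it. After the shift it holds the class leading to the vertex below, so the path can be followed
  from the top vertex down. The largest round receives the class that the top entry is about to
  examine.\<close>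

lemma rotated_nth:
  assumes "wf_stack s st" "active st"
  shows "Suc i < length st \<Longrightarrow> rotated s st (snd (st ! i)) = s (snd (st ! Suc i))"
    and "rotated s st (snd (last st)) = s (snd (hd st))"
    and "y \<notin> set (map snd st) \<Longrightarrow> rotated s st y = s y"
proof -
  let ?xs = "map snd st"
  have ne: "st \<noteq> []" using assms(2) by (auto simp: active_def)
  have "distinct ?xs"
    using wf_stackD[OF assms] strict_sorted_iff by blast
  from cyclic_rotation[OF this, of 1]
  have rot: "map (cycle_of_list ?xs) ?xs = rotate1 ?xs" by simp
  have *: "cycle_of_list ?xs (snd (st ! i)) = snd (st ! (Suc i mod length st))" if "i < length st" for i
  proof -
    have "cycle_of_list ?xs (snd (st ! i)) = map (cycle_of_list ?xs) ?xs ! i"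
      using that by simp
    also have "\<dots> = ?xs ! (Suc i mod length st)"
      unfolding rot using that by (subst nth_rotate1) auto
    finally show ?thesis using that ne by simp
  qed
  show "Suc i < length st \<Longrightarrow> rotated s st (snd (st ! i)) = s (snd (st ! Suc i))"
    using *[of i] by (simp add: rotated_def)
  show "rotated s st (snd (last st)) = s (snd (hd st))"
    using *[of "length st - 1"] ne by (simp add: rotated_def last_conv_nth hd_conv_nth)
  show "y \<notin> set ?xs \<Longrightarrow> rotated s st y = s y"
    by (simp add: rotated_def id_outside_supp)
qed

text \<open>Reading a path downwards: the next vertex is the partner of the current one in the class
  that the shifted order holds in the current round. This inverts the defining relation of the stack
  because \<open>partner\<close> is an involution.\<close>

lemma stack_vertex_eq:
  assumes s: "s permutes {..<n}" "wf_stack s st" "active st"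
    and s': "s' permutes {..<n}" "wf_stack s' st'" "active st'"
    and rot: "rotated s st = rotated s' st'"
    and hd: "fst (hd st) = fst (hd st')"
    and eq: "\<And>i. i < j \<Longrightarrow> snd (st ! i) = snd (st' ! i)"
    and j: "j < length st" "j < length st'"
  shows "fst (st ! j) = fst (st' ! j)"
  using eq j
proof (induction j)
  case 0
  then show ?case using hd by (simp add: hd_conv_nth)
next
  case (Suc j)
  have *: "fst (st ! Suc j) = partner n (rotated s st (snd (st ! j))) (fst (st ! j))"
    if "s permutes {..<n}" "wf_stack s st" "active st" "Suc j < length st" for s st
  proof -
    note D = wf_stackD[OF that(2,3)]
    have "fst (st ! j) = partner n (s (snd (st ! Suc j))) (fst (st ! Suc j))"
      "fst (st ! Suc j) < n"
      using D that(4) by blast+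
    moreover have "snd (st ! Suc j) < n"
      using that(4) conjunct1[OF conjunct2[OF D]] by (simp add: subset_iff)
    moreover have "s (snd (st ! Suc j)) < n"
      using permutes_in_image[OF that(1), of "snd (st ! Suc j)"] calculation(3) by simp
    ultimately show ?thesis
      using rotated_nth(1)[OF that(2,3,4)] partner_partner by metis
  qed
  have "fst (st ! j) = fst (st' ! j)" "snd (st ! j) = snd (st' ! j)"
    using Suc by auto
  then show ?case
    by (simp only: *[OF s Suc.prems(2)] *[OF s' Suc.prems(3)] rot)
qed

text \<open>The two stacks play symmetric roles, so it is enough to refute one direction of the
  inequality. The contradiction is that \<open>st'\<close> requires the common vertex to be free
  until its own, later round, whereas \<open>s'\<close> matches it in round
  \<open>\<tau>\<close>.\<close>

lemma no_first_difference:
  assumes s: "s permutes {..<n}" "wf_stack s st" "active st"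
    and s': "s' permutes {..<n}" "wf_stack s' st'" "active st'"
    and rot: "rotated s st = rotated s' st'"
    and hd: "fst (hd st) = fst (hd st')"
    and last: "snd (last st) = snd (last st')"
    and j: "j < length st" "j < length st'"
    and eq: "\<And>i. i < j \<Longrightarrow> snd (st ! i) = snd (st' ! i)"
  shows "\<not> snd (st ! j) < snd (st' ! j)"
proof
  assume less: "snd (st ! j) < snd (st' ! j)"
  define \<tau> where "\<tau> = snd (st ! j)"
  note D = wf_stackD[OF s(2,3)] and D' = wf_stackD[OF s'(2,3)]
  have ne: "st \<noteq> []" "st' \<noteq> []" using j by auto
  have nth_less: "snd (st ! i) < snd (st ! i')" if "i < i'" "i' < length st" for i i'
    using D that sorted_wrt_nth_less[of "(<)" "map snd st" i i'] by simp
  have nth_less': "snd (st' ! i) < snd (st' ! i')" if "i < i'" "i' < length st'" for i i'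
    using D' that sorted_wrt_nth_less[of "(<)" "map snd st'" i i'] by simp
  \<comment> \<open>The bottom rounds coincide and bound all rounds of \<open>st'\<close>. Hence
    entry \<open>j\<close> of \<open>st\<close>, having the smaller round, is not its bottom, and
    there is a next vertex in \<open>st\<close>.\<close>
  have "snd (st' ! j) \<le> snd (st' ! (length st' - 1))"
    using nth_less'[of j "length st' - 1"] j by (cases "j = length st' - 1") (auto simp: less_imp_le)
  also have "\<dots> = snd (st ! (length st - 1))"
    using last j by (metis last_conv_nth length_0_conv not_less_zero)
  finally have "j \<noteq> length st - 1" using less by auto
  then have Suc: "Suc j < length st" using j by simp
  have not_in: "y \<notin> set (map snd st')" if "y < snd (st' ! j)" "\<And>i. i < j \<Longrightarrow> y \<noteq> snd (st' ! i)" for y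
  proof
    assume "y \<in> set (map snd st')"
    then obtain i where i: "i < length st'" "y = snd (st' ! i)" by (auto simp: in_set_conv_nth)
    then show False
      using that nth_less'[of j i] by (cases i j rule: linorder_cases) auto
  qed
  have not_in0: "y \<notin> set (map snd st)" if "y < snd (st ! j)" "\<And>i. i < j \<Longrightarrow> y \<noteq> snd (st ! i)" for y
  proof
    assume "y \<in> set (map snd st)"
    then obtain i where i: "i < length st" "y = snd (st ! i)" by (auto simp: in_set_conv_nth)
    then show False
      using that nth_less[of j i] by (cases i j rule: linorder_cases) auto
  qed
  \<comment> \<open>A round below \<open>\<tau>\<close> is either among the \<open>j\<close> common
    rounds or on neither stack. A common round gets its value from the shared shifted order at its
    predecessor in the cycle; for the topmost round the predecessor is the shared bottom
    round.\<close>
  have agree: "s y = s' y" if y: "y < \<tau>" for y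
  proof (cases "\<exists>i<j. y = snd (st ! i)")
    case True
    then obtain i where i: "i < j" "y = snd (st ! i)" by blast
    show ?thesis
    proof (cases i)
      case 0
      then have "s y = rotated s st (snd (last st))"
        using rotated_nth(2)[OF s(2,3)] i 0 ne by (simp add: hd_conv_nth)
      also have "\<dots> = rotated s' st' (snd (last st'))" by (simp add: rot last)
      also have "\<dots> = s' y"
        using rotated_nth(2)[OF s'(2,3)] i eq[of 0] 0 ne by (simp add: hd_conv_nth)
      finally show ?thesis .
    next
      case (Suc i')
      then have "s y = rotated s st (snd (st ! i'))"
        using rotated_nth(1)[OF s(2,3), of i'] i j by simp
      also have "\<dots> = rotated s' st' (snd (st' ! i'))" using eq[of i'] i Suc rot by simp
      also have "\<dots> = s' y"
        using rotated_nth(1)[OF s'(2,3), of i'] i j eq[of i] Suc by simp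
      finally show ?thesis .
    qed
  next
    case False
    then have "y \<notin> set (map snd st)" using y not_in0 by (auto simp: \<tau>_def)
    moreover have "y \<notin> set (map snd st')"
      using False y less eq by (intro not_in) (auto simp: \<tau>_def)
    ultimately show ?thesis
      using rotated_nth(3)[OF s(2,3), of y] rotated_nth(3)[OF s'(2,3), of y] rot by simp
  qed
  then have same: "matched s \<tau> = matched s' \<tau>"
    by (rule matched_cong)
  have vj: "fst (st ! j) = fst (st' ! j)"
    using stack_vertex_eq[OF s s' rot hd eq j] .
  \<comment> \<open>The rounds of \<open>st'\<close> smaller than that of its entry \<open>j\<close>
    are common ones, so the second cycle fixes \<open>\<tau>\<close>. Therefore \<open>s'\<close>
    itself holds in round \<open>\<tau>\<close> the class of the edge between the entries
    \<open>j\<close> and \<open>j + 1\<close> of \<open>st\<close>, whose ends are both still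
    free.\<close>
  have "\<tau> \<notin> set (map snd st')"
    using less eq nth_less[of _ j] j by (intro not_in) (fastforce simp: \<tau>_def)+
  then have "s' \<tau> = rotated s' st' \<tau>"
    using rotated_nth(3)[OF s'(2,3)] by simp
  also have "\<dots> = s (snd (st ! Suc j))"
    using rotated_nth(1)[OF s(2,3) Suc] rot by (simp add: \<tau>_def)
  finally have s'\<tau>: "s' \<tau> = s (snd (st ! Suc j))" .
  have a: "fst (st ! j) = partner n (s (snd (st ! Suc j))) (fst (st ! Suc j))"
    "{fst (st ! j), fst (st ! Suc j)} \<in> E" "fst (st ! Suc j) < n" "fst (st ! j) < n"
    "fst (st ! j) \<notin> matched s \<tau>"
    "fst (st ! Suc j) \<notin> matched s (snd (st ! Suc j))"
    using D Suc j unfolding \<tau>_def by blast+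
  have a5: "snd (st ! Suc j) < n"
    using Suc conjunct1[OF conjunct2[OF D]] by (simp add: subset_iff)
  have "s (snd (st ! Suc j)) < n"
    using permutes_in_image[OF s(1), of "snd (st ! Suc j)"] a5 by simp
  then have b: "partner n (s' \<tau>) (fst (st ! j)) = fst (st ! Suc j)"
    using a(1,3) partner_partner s'\<tau> by simp
  have "fst (st ! Suc j) \<notin> matched s \<tau>"
    using a(6) matched_mono[of \<tau> "snd (st ! Suc j)"] nth_less[of j "Suc j"] Suc
    by (auto simp: \<tau>_def)
  then have "fst (st ! j) \<in> matched s' (Suc \<tau>)"
    using a(2,4,5) b same by simp
  then have "fst (st' ! j) \<in> matched s' (snd (st' ! j))"
    using matched_mono[of "Suc \<tau>" "snd (st' ! j)"] less vj by (auto simp: \<tau>_def)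
  then show False using D' j by blast
qed

text \<open>Rounds agree up to the shorter length; as they increase strictly and end in the same
  value, neither list is a proper prefix of the other. Equal stacks give equal cycles, and these
  cancel because they are bijections.\<close>

lemma rotated_inj:
  assumes s: "s permutes {..<n}" "wf_stack s st" "active st"
    and s': "s' permutes {..<n}" "wf_stack s' st'" "active st'"
    and rot: "rotated s st = rotated s' st'"
    and hd: "fst (hd st) = fst (hd st')"
    and last: "snd (last st) = snd (last st')"
  shows "s = s' \<and> st = st'"
proof -
  have times: "snd (st ! j) = snd (st' ! j)" if "j < length st" "j < length st'" for j
    using that
  proof (induction j rule: less_induct)
    case (less j)
    then have "\<And>i. i < j \<Longrightarrow> snd (st ! i) = snd (st' ! i)" by simp
    then show ?case
      using no_first_difference[OF s s' rot hd last less.prems]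
        no_first_difference[OF s' s rot[symmetric] hd[symmetric] last[symmetric] less.prems(2,1)]
      by (metis linorder_neqE_nat)
  qed
  have *: "\<not> length st < length st'"
    if "wf_stack s st" "active st" "wf_stack s' st'" "active st'" "snd (last st) = snd (last st')"
      "\<And>j. j < length st \<Longrightarrow> j < length st' \<Longrightarrow> snd (st ! j) = snd (st' ! j)" for s s' st st'
  proof
    assume l: "length st < length st'"
    have ne: "st \<noteq> []" "st' \<noteq> []" using that by (auto simp: active_def)
    have "snd (st' ! (length st - 1)) < snd (st' ! (length st' - 1))"
      using wf_stackD[OF that(3,4)] l ne
        sorted_wrt_nth_less[of "(<)" "map snd st'" "length st - 1" "length st' - 1"]
      by (simp add: diff_less_mono Suc_le_eq)
    also have "\<dots> = snd (st ! (length st - 1))"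
      using that(5) ne by (simp add: last_conv_nth)
    also have "\<dots> = snd (st' ! (length st - 1))"
      using that(6) l ne by simp
    finally show False by simp
  qed
  have len: "length st = length st'"
    using *[OF s(2,3) s'(2,3) last times] *[OF s'(2,3) s(2,3) last[symmetric] times[symmetric]] by simp
  have st: "st = st'"
    using len times stack_vertex_eq[OF s s' rot hd] by (intro nth_equalityI prod_eqI) auto
  moreover have "s = s'"
  proof
    fix y
    obtain z where "y = cycle_of_list (map snd st) z"
      using permutes_surj[OF cycle_permutes] by (metis surjD)
    then show "s y = s' y"
      using fun_cong[OF rot, of z] st by (simp add: rotated_def)
  qed
  ultimately show ?thesis by blast
qed


section \<open>Counting stacks over all orders\<close>

abbreviation perms :: "(nat \<Rightarrow> nat) set" where
  "perms \<equiv> {s. s permutes {..<n}}"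

lemma finite_perms: "finite perms"
  by (simp add: finite_permutations)

lemma card_perms: "card perms = fact n"
  by (simp add: card_permutations)

definition stacks :: "(nat \<Rightarrow> nat) \<Rightarrow> (nat \<times> nat) list set" where
  "stacks s = {st. wf_stack s st \<and> st \<noteq> []}"

definition active_stacks :: "(nat \<Rightarrow> nat) \<Rightarrow> (nat \<times> nat) list set" where
  "active_stacks s = {st. wf_stack s st \<and> active st}"

lemma active_length:
  assumes "wf_stack s st" "active st"
  shows "length st \<le> n"
proof -
  have "distinct (map snd st)" "set (map snd st) \<subseteq> {..<n}"
    using wf_stackD[OF assms] strict_sorted_iff by blast+
  then have "length (map snd st) \<le> card {..<n}"
    by (metis card_mono distinct_card finite_lessThan)
  then show ?thesis by simp
qed

lemma wf_stack_tl:
  assumes "wf_stack s ((a, x) # st)" "st \<noteq> []"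
  shows "wf_stack s st" "active st"
  using assms by (auto simp: active_def split: list.splits prod.splits)

lemma wf_stack_length:
  assumes "wf_stack s st"
  shows "length st \<le> Suc n"
proof (cases st)
  case (Cons p st')
  then show ?thesis
    using assms wf_stack_tl[of s "fst p" "snd p" st'] active_length[of s st'] by (cases "st' = []") auto
qed simp

lemma limit_le: "wf_stack s st \<Longrightarrow> limit st \<le> n"
proof (induction st)
  case (Cons p st)
  then show ?case by (cases p) auto
qed simp

lemma wf_stack_set: "wf_stack s st \<Longrightarrow> set st \<subseteq> {..<n} \<times> {..n}"
proof (induction st)
  case (Cons p st)
  then show ?case using limit_le[of s st] by (cases p) auto
qed simp

lemma finite_stacks: "finite (stacks s)"
proof (rule finite_subset)
  show "stacks s \<subseteq> {xs. set xs \<subseteq> {..<n} \<times> {..n} \<and> length xs \<le> Suc n}"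
    using wf_stack_set wf_stack_length by (auto simp: stacks_def)
  show "finite {xs. set xs \<subseteq> {..<n} \<times> {..n} \<and> length xs \<le> Suc n}"
    by (rule finite_lists_length_le) simp
qed

lemma active_stacks_subset: "active_stacks s \<subseteq> stacks s"
  by (auto simp: active_stacks_def stacks_def active_def)

text \<open>An active stack is encoded by the shifted order, the top vertex and the bottom round;
  the last two cost a factor \<open>n\<close> each. On average over the orders this leaves
  \<open>n\<close> active stacks per start vertex.\<close>

lemma sum_card_active_stacks: "(\<Sum>s\<in>perms. card (active_stacks s)) \<le> fact n * n * n"
proof -
  define f where "f = (\<lambda>(s, st :: (nat \<times> nat) list). (rotated s st, fst (hd st), snd (last st)))"
  have fin: "finite (active_stacks s)" for s
    using finite_stacks active_stacks_subset finite_subset by blast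
  have "(\<Sum>s\<in>perms. card (active_stacks s)) = card (Sigma perms active_stacks)"
    using finite_perms fin by (simp add: card_SigmaI)
  also have "\<dots> \<le> card (perms \<times> {..<n} \<times> {..<n})"
  proof (rule card_inj_on_le)
    show "inj_on f (Sigma perms active_stacks)"
      using rotated_inj by (auto simp: inj_on_def f_def active_stacks_def)
    show "f ` Sigma perms active_stacks \<subseteq> perms \<times> {..<n} \<times> {..<n}"
    proof (rule image_subsetI)
      fix p
      assume "p \<in> Sigma perms active_stacks"
      then obtain s st where p: "p = (s, st)" and s: "s permutes {..<n}" and st: "st \<in> active_stacks s"
        by auto
      then have w: "wf_stack s st" "active st" by (auto simp: active_stacks_def)
      then have ne: "st \<noteq> []" by (auto simp: active_def)
      have "fst (hd st) < n"
        using wf_stackD[OF w] ne by (metis hd_conv_nth length_greater_0_conv)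
      moreover have "snd (last st) < n"
        using wf_stackD[OF w] last_in_set[OF ne] by auto
      ultimately show "f p \<in> perms \<times> {..<n} \<times> {..<n}"
        using rotated_permutes[OF s w] by (simp add: f_def p)
    qed
    show "finite (perms \<times> {..<n} \<times> {..<n})"
      using finite_perms by simp
  qed
  also have "\<dots> = fact n * n * n"
    by (simp add: card_cartesian_product card_perms)
  finally show ?thesis .
qed

text \<open>An inactive stack is determined by what lies below its top: the top round is the limit
  and the top vertex is the partner of the vertex below. So it is charged to the active stack
  underneath, unless it is a single entry in round \<open>n\<close>.\<close>

lemma card_stacks: "card (stacks s) \<le> 2 * card (active_stacks s) + n"
proof -
  define top where "top = (\<lambda>st :: (nat \<times> nat) list. (partner n (s (snd (hd st))) (fst (hd st)), snd (hd st)) # st)"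
  have fin: "finite (active_stacks s)"
    using finite_stacks active_stacks_subset finite_subset by blast
  have "stacks s \<subseteq> active_stacks s \<union> top ` active_stacks s \<union> (\<lambda>a. [(a, n)]) ` {..<n}"
  proof
    fix st
    assume "st \<in> stacks s"
    then obtain a x st' where st: "st = (a, x) # st'" "wf_stack s st"
      by (cases st) (auto simp: stacks_def)
    show "st \<in> active_stacks s \<union> top ` active_stacks s \<union> (\<lambda>a. [(a, n)]) ` {..<n}"
    proof (cases "active st")
      case True
      then show ?thesis using st by (simp add: active_stacks_def)
    next
      case False
      then have x: "x = limit st'"
        using st by (simp add: active_def)
      show ?thesis
      proof (cases st')
        case Nil
        then show ?thesis using st x by auto
      next
        case (Cons q st'')
        then have "wf_stack s st'" "active st'"
          using wf_stack_tl st by blast+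
        moreover have "st = top st'"
          using st x Cons by (cases q) (simp add: top_def)
        ultimately show ?thesis by (auto simp: active_stacks_def)
      qed
    qed
  qed
  then have "card (stacks s) \<le> card (active_stacks s \<union> top ` active_stacks s \<union> (\<lambda>a. [(a, n)]) ` {..<n})"
    using fin by (intro card_mono) auto
  also have "\<dots> \<le> card (active_stacks s) + card (top ` active_stacks s) + card ((\<lambda>a. [(a, n)]) ` {..<n})"
    by (meson card_Un_le order_trans add_le_mono1)
  also have "\<dots> \<le> card (active_stacks s) + card (active_stacks s) + n"
    using card_image_le[OF fin, of top] card_image_le[of "{..<n}" "\<lambda>a. [(a, n)]"]
    by (intro add_mono) auto
  finally show ?thesis by simp
qed

section \<open>Evaluating the recursion with a bounded number of steps\<close>

fun advance :: "(nat \<Rightarrow> nat) \<Rightarrow> (nat \<times> nat) list \<Rightarrow> (nat \<times> nat) list" where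
  "advance s [] = []"
| "advance s ((a, x) # st) =
    (if x < limit st
     then if {a, partner n (s x) a} \<in> E then (partner n (s x) a, 0) # (a, x) # st
          else (a, Suc x) # st
     else case st of _ # (b, y) # st' \<Rightarrow> (b, Suc y) # st' | _ \<Rightarrow> [])"

text \<open>A single entry at its limit is a start vertex that stayed free in all rounds. With two
  entries, the top one at its limit, the start vertex has found a free partner. Thus the height
  minus 1 is the answer.\<close>

definition final :: "(nat \<times> nat) list \<Rightarrow> bool" where
  "final st \<longleftrightarrow> \<not> active st \<and> length st \<le> 2"

text \<open>Running out of steps is reported as 0, that is as unmatched, so truncation errs in one
  direction only. Recognizing a final stack also uses up a step.\<close>

fun explore :: "(nat \<Rightarrow> nat) \<Rightarrow> nat \<Rightarrow> (nat \<times> nat) list \<Rightarrow> nat" where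
  "explore s 0 st = 0"
| "explore s (Suc b) st = (if final st then length st - 1 else explore s b (advance s st))"

text \<open>
  The order in which the exploration visits the stacks; as it never returns to a stack, the number of
  well-formed stacks over the start vertex bounds its length.
\<close>

definition before :: "(nat \<times> nat) list \<Rightarrow> (nat \<times> nat) list \<Rightarrow> bool" where
  "before st st' \<longleftrightarrow> (rev (map snd st), rev (map snd st')) \<in> lexord less_than"

lemma before_irrefl: "\<not> before st st"
  unfolding before_def by (rule lexord_irreflexive) auto

lemma before_trans: "before st1 st2 \<Longrightarrow> before st2 st3 \<Longrightarrow> before st1 st3"
  unfolding before_def by (rule lexord_trans) (auto simp: trans_def)

text \<open>By the invariant both vertices are free when round \<open>z\<close> begins, so this
  round matches them. A top entry that reaches its limit therefore settles the vertex below
  it.\<close>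

lemma popped_matched:
  assumes w: "wf_stack s ((a, x) # (c, z) # st)" and x: "\<not> x < z"
  shows "c \<in> matched s (Suc z)"
proof -
  have "x = z" using w x by simp
  then have "a \<notin> matched s z" "c \<notin> matched s z" "c < n" "a = partner n (s z) c" "{c, a} \<in> E"
    using w by (auto simp: insert_commute)
  then show ?thesis by simp
qed

lemma advance_wf:
  assumes w: "wf_stack s st" "st \<noteq> []" "\<not> final st"
  shows "wf_stack s (advance s st) \<and> advance s st \<noteq> [] \<and>
    fst (last (advance s st)) = fst (last st) \<and> before st (advance s st)"
proof -
  obtain a x st' where st: "st = (a, x) # st'" using w(2) by (cases st) auto
  have a: "a < n" "a \<notin> matched s x" using w(1) by (auto simp: st)
  show ?thesis
  proof (cases "x < limit st'")
    case True
    let ?p = "partner n (s x) a"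
    show ?thesis
    proof (cases "{a, ?p} \<in> E")
      case edge: True
      have "before st ((?p, 0) # st)"
        unfolding before_def by (simp add: lexord_append_rightI)
      moreover have "wf_stack s ((?p, 0) # st)"
        using w(1) True edge a by (simp add: st partner_less insert_commute)
      ultimately show ?thesis using True edge by (simp add: st)
    next
      case False
      have "before st ((a, Suc x) # st')"
        by (simp add: st before_def lexord_append_leftI)
      moreover have "wf_stack s ((a, Suc x) # st')"
        using w(1) True False by (auto simp: st split: list.splits)
      ultimately show ?thesis using True False by (simp add: st)
    qed
  next
    case False
    then have "\<not> length st \<le> 2"
      using w(3) by (simp add: final_def active_def st)
    then obtain c z b y st2 where st': "st' = (c, z) # (b, y) # st2"
      unfolding st by (cases st'; cases "tl st'") auto
    have adv: "advance s st = (b, Suc y) # st2"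
      using False by (simp add: st st')
    have wz: "wf_stack s ((c, z) # (b, y) # st2)" "z < y" and wy: "wf_stack s ((b, y) # st2)" "y < limit st2"
      using w(1) by (auto simp: st st')
    have "wf_stack s ((a, x) # (c, z) # (b, y) # st2)" "\<not> x < z"
      using w(1) False by (simp_all only: st st' limit.simps not_False_eq_True)
    then have "c \<in> matched s (Suc z)" by (rule popped_matched)
    \<comment> \<open>The vertex \<open>c\<close> is the partner that \<open>b\<close> was waiting
      for in round \<open>y\<close>, but it was taken in the earlier round \<open>z\<close>. So
      round \<open>y\<close> leaves \<open>b\<close> free, which is why two entries are popped and
      \<open>b\<close> moves on.\<close>
    then have "c \<in> matched s y"
      using matched_mono[of "Suc z" y] wz(2) by auto
    then have "b \<notin> matched s (Suc y)"
      using wz wy by auto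
    then have "wf_stack s ((b, Suc y) # st2)"
      using wy by (auto split: list.splits)
    moreover have "before st ((b, Suc y) # st2)"
      by (simp add: st st' before_def lexord_append_leftI)
    ultimately show ?thesis
      unfolding adv by (simp add: st st' del: wf_stack.simps matched.simps)
  qed
qed

lemma final_result:
  assumes w: "wf_stack s st" "st \<noteq> []" "final st"
  shows "length st - 1 = of_bool (fst (last st) \<in> matched s n)"
proof -
  obtain a x st' where st: "st = (a, x) # st'" using w(2) by (cases st) auto
  have nx: "\<not> x < limit st'" "length st' \<le> 1"
    using w(3) by (auto simp: final_def active_def st)
  show ?thesis
  proof (cases st')
    case Nil
    then show ?thesis using w(1) nx by (auto simp: st)
  next
    case (Cons q st2)
    then obtain c z where st': "st' = [(c, z)]" using nx(2) by (cases q) auto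
    have "wf_stack s ((a, x) # (c, z) # [])" "\<not> x < z"
      using w(1) nx(1) by (simp_all only: st st' limit.simps not_False_eq_True)
    then have "c \<in> matched s (Suc z)" by (rule popped_matched)
    moreover have "z < n" using w(1) by (simp add: st st')
    ultimately have "c \<in> matched s n"
      using matched_mono[of "Suc z" n] by auto
    then show ?thesis by (simp add: st st')
  qed
qed

lemma explore_le:
  assumes "wf_stack s st" "st \<noteq> []"
  shows "explore s b st \<le> of_bool (fst (last st) \<in> matched s n)"
  using assms
proof (induction b arbitrary: st)
  case (Suc b)
  show ?case
  proof (cases "final st")
    case True
    then show ?thesis using final_result[OF Suc.prems] by simp
  next
    case False
    with Suc.IH[of "advance s st"] advance_wf[OF Suc.prems False] show ?thesis by simp
  qed
qed simp

definition later_stacks :: "(nat \<Rightarrow> nat) \<Rightarrow> (nat \<times> nat) list \<Rightarrow> (nat \<times> nat) list set" where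
  "later_stacks s st = {st' \<in> stacks s. fst (last st') = fst (last st) \<and> (st' = st \<or> before st st')}"

lemma finite_later_stacks: "finite (later_stacks s st)"
  using finite_stacks[of s] by (rule rev_finite_subset) (auto simp: later_stacks_def)

text \<open>Each step passes to a later stack over the same start vertex, so the set of stacks still
  to come loses at least the current one. That set contains the current stack because a final stack
  needs one more step to be recognized.\<close>

lemma explore_eq:
  assumes "wf_stack s st" "st \<noteq> []" "card (later_stacks s st) \<le> b"
  shows "explore s b st = of_bool (fst (last st) \<in> matched s n)"
  using assms
proof (induction b arbitrary: st)
  case 0
  have "finite (later_stacks s st)" "st \<in> later_stacks s st"
    using 0 finite_later_stacks by (auto simp: later_stacks_def stacks_def)
  with 0 show ?case by auto
next
  case (Suc b)
  show ?case
  proof (cases "final st")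
    case True
    then show ?thesis using final_result Suc by simp
  next
    case False
    note adv = advance_wf[OF Suc.prems(1,2) False]
    have "later_stacks s (advance s st) \<subseteq> later_stacks s st - {st}"
      using adv before_trans before_irrefl by (auto simp: later_stacks_def)
    moreover have "finite (later_stacks s st)" "st \<in> later_stacks s st"
      using Suc.prems finite_later_stacks by (auto simp: later_stacks_def stacks_def)
    ultimately have "card (later_stacks s (advance s st)) < card (later_stacks s st)"
      by (intro psubset_card_mono) auto
    then have "explore s b (advance s st) = of_bool (fst (last (advance s st)) \<in> matched s n)"
      using adv Suc.prems(3) by (intro Suc.IH) auto
    then show ?thesis using False adv by simp
  qed
qed

section \<open>Average loss caused by the step bound\<close>

definition hits :: "nat \<Rightarrow> nat" where
  "hits b = (\<Sum>s\<in>perms. \<Sum>v<n. explore s b [(v, 0)])"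

definition hits_all :: nat where
  "hits_all = (\<Sum>s\<in>perms. card (matched s n))"

lemma card_matched: "card (matched s n) = (\<Sum>v<n. of_bool (v \<in> matched s n))"
  using matched_subset[of s n] by (simp add: of_bool_def sum.If_cases Int_absorb1 Int_absorb2)

lemma explore_start:
  assumes "v < n"
  shows "explore s b [(v, 0)] \<le> of_bool (v \<in> matched s n)"
    and "card {st \<in> stacks s. fst (last st) = v} \<le> b \<Longrightarrow>
      explore s b [(v, 0)] = of_bool (v \<in> matched s n)"
proof -
  show "explore s b [(v, 0)] \<le> of_bool (v \<in> matched s n)"
    using explore_le[of s "[(v, 0)]" b] assms by simp
  assume "card {st \<in> stacks s. fst (last st) = v} \<le> b"
  moreover have "card (later_stacks s [(v, 0)]) \<le> card {st \<in> stacks s. fst (last st) = v}"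
    using finite_stacks[of s] by (intro card_mono) (auto simp: later_stacks_def)
  ultimately show "explore s b [(v, 0)] = of_bool (v \<in> matched s n)"
    using explore_eq[of s "[(v, 0)]" b] assms by simp
qed

lemma hits_le: "hits b \<le> hits_all"
  unfolding hits_def hits_all_def card_matched
  by (intro sum_mono) (simp add: explore_start(1))

text \<open>Markov's inequality in summed form: an answer can be lost only if more than
  \<open>b\<close> stacks stand over the start vertex, and these pay for the \<open>b\<close> on the
  left. In the constant 3, two units come from the active stacks in \<open>card_stacks\<close> and
  one from the single entries in round \<open>n\<close>.\<close>

lemma hits_ge:
  "b * hits_all \<le> b * hits b + 3 * (fact n * n * n)"
proof -
  let ?c = "\<lambda>s v. card {st \<in> stacks s. fst (last st) = v}"
  have one: "b * of_bool (v \<in> matched s n) \<le> b * explore s b [(v, 0)] + ?c s v"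
    if "v < n" for s v
    using explore_start(2)[OF that, of s b] by (cases "?c s v \<le> b") auto
  have "b * hits_all = (\<Sum>s\<in>perms. \<Sum>v<n. b * of_bool (v \<in> matched s n))"
    by (simp only: hits_all_def card_matched sum_distrib_left)
  also have "\<dots> \<le> (\<Sum>s\<in>perms. \<Sum>v<n. b * explore s b [(v, 0)] + ?c s v)"
    using one by (intro sum_mono) auto
  also have "\<dots> = b * hits b + (\<Sum>s\<in>perms. \<Sum>v<n. ?c s v)"
    by (simp add: hits_def sum.distrib sum_distrib_left)
  also have "(\<Sum>s\<in>perms. \<Sum>v<n. ?c s v) = (\<Sum>s\<in>perms. card (stacks s))"
  proof (rule sum.cong[OF refl])
    fix s
    have "(\<Sum>v<n. ?c s v) = card (\<Union>v<n. {st \<in> stacks s. fst (last st) = v})"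
      using finite_stacks[of s] by (subst card_UN_disjoint) auto
    also have "(\<Union>v<n. {st \<in> stacks s. fst (last st) = v}) = stacks s"
    proof -
      have "fst (last st) < n" if "st \<in> stacks s" for st
      proof -
        have "last st \<in> {..<n} \<times> {..n}"
          using that wf_stack_set[of s st] last_in_set[of st] unfolding stacks_def by blast
        then show ?thesis by (cases "last st") simp
      qed
      then show ?thesis by auto
    qed
    finally show "(\<Sum>v<n. ?c s v) = card (stacks s)" .
  qed
  also have "\<dots> \<le> (\<Sum>s\<in>perms. 2 * card (active_stacks s) + n)"
    by (intro sum_mono card_stacks)
  also have "\<dots> = 2 * (\<Sum>s\<in>perms. card (active_stacks s)) + fact n * n"
    by (simp add: sum.distrib sum_distrib_left card_perms)
  also have "\<dots> \<le> 2 * (fact n * n * n) + fact n * n * n"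
    using sum_card_active_stacks by (intro add_mono mult_left_mono) (cases n; auto)+
  finally show ?thesis by (simp add: mult.commute mult.left_commute)
qed


section \<open>The matched vertices as a maximal matching and as a cover\<close>

primrec greedy_matching :: "(nat \<Rightarrow> nat) \<Rightarrow> nat \<Rightarrow> nat set set" where
  "greedy_matching s 0 = {}"
| "greedy_matching s (Suc t) = greedy_matching s t \<union> {e \<in> E. \<exists>u<n. e = {u, partner n (s t) u} \<and>
     u \<notin> matched s t \<and> partner n (s t) u \<notin> matched s t}"

text \<open>Edges chosen in one round are disjoint because \<open>partner\<close> is an involution
  there; edges of different rounds are disjoint because a round uses only free vertices.\<close>

lemma greedy_matching:
  assumes s: "s permutes {..<n}" and t: "t \<le> n"
  shows "greedy_matching s t \<subseteq> E \<and> \<Union> (greedy_matching s t) = matched s t \<and> disjoint (greedy_matching s t)"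
  using t
proof (induction t)
  case (Suc t)
  define N where "N = {e \<in> E. \<exists>u<n. e = {u, partner n (s t) u} \<and>
     u \<notin> matched s t \<and> partner n (s t) u \<notin> matched s t}"
  have IH: "greedy_matching s t \<subseteq> E" "\<Union> (greedy_matching s t) = matched s t" "disjoint (greedy_matching s t)"
    using Suc by auto
  have "s t < n"
    using permutes_in_image[OF s, of t] Suc.prems by simp
  then have inv: "partner n (s t) (partner n (s t) u) = u" if "u < n" for u
    using partner_partner that by blast
  have p: "partner n (s t) u < n" for u
    using Suc.prems by (simp add: partner_less)
  have "\<Union> N = {u. u < n \<and> u \<notin> matched s t \<and> partner n (s t) u \<notin> matched s t \<and> {u, partner n (s t) u} \<in> E}"
    (is "_ = ?R")
  proof
    show "\<Union> N \<subseteq> ?R" using inv p by (auto simp: N_def insert_commute)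
    show "?R \<subseteq> \<Union> N" unfolding N_def by blast
  qed
  moreover have "disjoint N"
  proof (rule disjointI)
    fix e f
    assume "e \<in> N" "f \<in> N" "e \<noteq> f"
    then obtain u v where "u < n" "v < n" "e = {u, partner n (s t) u}" "f = {v, partner n (s t) v}"
      by (auto simp: N_def)
    with inv \<open>e \<noteq> f\<close> show "e \<inter> f = {}"
      by (auto simp: insert_commute) (metis insert_commute)+
  qed
  moreover have "\<Union> (greedy_matching s t) \<inter> \<Union> N = {}"
    unfolding IH(2) by (auto simp: N_def)
  moreover have "greedy_matching s (Suc t) = greedy_matching s t \<union> N"
    by (simp add: N_def)
  ultimately show ?case
    using IH disjoint_union[of "greedy_matching s t" N] by (auto simp: N_def)
qed simp

text \<open>The class of an edge has its own round, since \<open>s\<close> is onto. If both ends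
  were free at the end, they would be free in that round and would be matched by it.\<close>

lemma matched_cover:
  assumes g: "simple_graph n E" and s: "s permutes {..<n}"
  shows "is_vertex_cover n E (matched s n)"
  unfolding is_vertex_cover_def
proof (intro conjI ballI matched_subset)
  fix e
  assume "e \<in> E"
  then obtain u v where e: "e = {u, v}" "u < n" "v < n" "{u, v} \<in> E"
    using g by (auto simp: simple_graph_def)
  then obtain c where c: "c < n" "partner n c u = v"
    using ex_partner by blast
  obtain i where i: "i < n" "s i = c"
    using permutes_image[OF s] c(1) by (metis imageE lessThan_iff)
  show "e \<inter> matched s n \<noteq> {}"
  proof
    assume "e \<inter> matched s n = {}"
    then have "u \<notin> matched s n" "v \<notin> matched s n" using e by auto
    moreover from this have "u \<notin> matched s i" "v \<notin> matched s i"
      using matched_mono[of i n] i by auto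
    then have "u \<in> matched s (Suc i)"
      using e c i by simp
    ultimately show False
      using matched_mono[of "Suc i" n s] i by auto
  qed
qed

lemma finite_edges: "simple_graph n E \<Longrightarrow> finite E"
  by (rule finite_subset[of _ "Pow {..<n}"]) (auto simp: simple_graph_def)

lemma matching_le_cover:
  assumes "is_matching E N" "is_vertex_cover n E C"
  shows "card N \<le> card C"
proof -
  have "\<forall>e\<in>N. \<exists>v. v \<in> e \<inter> C"
    using assms by (auto simp: is_matching_def is_vertex_cover_def)
  then obtain f where f: "\<And>e. e \<in> N \<Longrightarrow> f e \<in> e \<inter> C"
    by metis
  show ?thesis
  proof (rule card_inj_on_le)
    show "inj_on f N"
      using f assms(1) disjointD unfolding inj_on_def is_matching_def by (metis IntE disjoint_iff)
    show "f ` N \<subseteq> C" using f by auto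
    show "finite C" using assms(2) finite_subset by (auto simp: is_vertex_cover_def)
  qed
qed

text \<open>The matched set is a vertex cover and at the same time twice as large as a matching. So
  this one size lies between each of the two optima and its double, and sampling it serves both
  estimates.\<close>

lemma card_matched_bounds:
  assumes g: "simple_graph n E" and s: "s permutes {..<n}"
  shows "max_matching_size E \<le> card (matched s n)"
    and "card (matched s n) \<le> 2 * max_matching_size E"
    and "min_vertex_cover_size n E \<le> card (matched s n)"
    and "card (matched s n) \<le> 2 * min_vertex_cover_size n E"
proof -
  let ?M = "greedy_matching s n"
  have fM: "finite {N. is_matching E N}"
    using finite_edges[OF g] by (rule finite_subset[rotated, OF finite_Pow_iff[THEN iffD2]]) (auto simp: is_matching_def)
  have fC: "finite {C. is_vertex_cover n E C}"
    by (rule finite_subset[of _ "Pow {..<n}"]) (auto simp: is_vertex_cover_def)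
  have M: "is_matching E ?M" "\<Union> ?M = matched s n"
    using greedy_matching[OF s order_refl] by (auto simp: is_matching_def)
  have C: "is_vertex_cover n E (matched s n)"
    by (rule matched_cover[OF g s])
  have two: "card e = 2" if "e \<in> ?M" for e
  proof -
    have "e \<in> E" using that M(1) by (auto simp: is_matching_def)
    then show ?thesis using g by (auto simp: simple_graph_def)
  qed
  have "card (\<Union> ?M) = sum card ?M"
    using M(1) two by (intro card_Union_disjoint)
      (auto simp: is_matching_def disjoint_def pairwise_def disjnt_def intro: card_ge_0_finite)
  then have card: "card (matched s n) = 2 * card ?M"
    using M(2) two by simp
  show "max_matching_size E \<le> card (matched s n)"
    unfolding max_matching_size_def using fM M(1) matching_le_cover[OF _ C]
    by (subst Max_le_iff) auto
  show "card (matched s n) \<le> 2 * max_matching_size E"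
    unfolding card max_matching_size_def using fM M(1) by (intro mult_left_mono Max_ge) auto
  show "min_vertex_cover_size n E \<le> card (matched s n)"
    unfolding min_vertex_cover_size_def using fC C by (intro Min_le) auto
  have "card ?M \<le> min_vertex_cover_size n E"
    unfolding min_vertex_cover_size_def using fC C matching_le_cover[OF M(1)]
    by (subst Min_ge_iff) auto
  then show "card (matched s n) \<le> 2 * min_vertex_cover_size n E"
    by (simp add: card)
qed

end

section \<open>Reasoning about randomized programs\<close>

text \<open>Random branches halt after different numbers of steps; asking for all large
  \<open>l\<close> lets the maximum over a finite support serve every branch. One bound
  \<open>T\<close> serves time and queries. The output law is exact, which separates the
  probabilistic estimates from the program.\<close>

definition reaches :: "nat set set \<Rightarrow> config \<Rightarrow> nat \<Rightarrow> (nat \<times> nat) pmf \<Rightarrow> bool" where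
  "reaches E c T A \<longleftrightarrow> (\<exists>L. \<forall>l\<ge>L.
     (\<forall>c'\<in>set_pmf (steps E l c). halted c' \<and> time_used c' \<le> T \<and> queries_used c' \<le> T) \<and>
     map_pmf (\<lambda>c'. (matching_output c', vertex_cover_output c')) (steps E l c) = A)"

lemma steps_halted: "steps E l (Config [] m t q) = return_pmf (Config [] m t q)"
  by (induction l) (simp_all add: bind_return_pmf)

lemma reaches_halted:
  "t \<le> T \<Longrightarrow> q \<le> T \<Longrightarrow> reaches E (Config [] m t q) T (return_pmf (m 1 0, m 2 0))"
  unfolding reaches_def
  by (auto simp: steps_halted halted_def matching_output_def vertex_cover_output_def)

lemma reaches_bind:
  assumes "finite (set_pmf (step E c))" "\<And>c'. c' \<in> set_pmf (step E c) \<Longrightarrow> reaches E c' T (A c')"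
  shows "reaches E c T (bind_pmf (step E c) A)"
proof -
  let ?P = "\<lambda>l c A. (\<forall>c'\<in>set_pmf (steps E l c). halted c' \<and> time_used c' \<le> T \<and> queries_used c' \<le> T) \<and>
     map_pmf (\<lambda>c'. (matching_output c', vertex_cover_output c')) (steps E l c) = A"
  obtain L where L: "\<And>c' l. c' \<in> set_pmf (step E c) \<Longrightarrow> L c' \<le> l \<Longrightarrow> ?P l c' (A c')"
    using assms(2) unfolding reaches_def by metis
  have "?P l c (bind_pmf (step E c) A)" if l: "Suc (Max (L ` set_pmf (step E c))) \<le> l" for l
  proof -
    obtain l' where l': "l = Suc l'" using l by (cases l) auto
    have "L c' \<le> l'" if "c' \<in> set_pmf (step E c)" for c'
      using l l' Max_ge[of "L ` set_pmf (step E c)" "L c'"] assms(1) that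
      by (meson Suc_le_mono finite_imageI imageI order_trans)
    then have *: "?P l' c' (A c')" if "c' \<in> set_pmf (step E c)" for c'
      using L that by blast
    then show ?thesis
      unfolding l' by (auto simp: map_bind_pmf intro!: bind_pmf_cong)
  qed
  then show ?thesis unfolding reaches_def by blast
qed

lemma reaches_return:
  assumes "step E c = return_pmf c'" "reaches E c' T A"
  shows "reaches E c T A"
  using reaches_bind[of E c T "\<lambda>_. A"] assms by (simp add: bind_return_pmf)

text \<open>
  The postcondition is indexed by the sampled value; \<open>B\<close> bounds the time. The quantified
  \<open>A'\<close> is the output distribution of the rest of the program.
\<close>

definition triple :: "nat set set \<Rightarrow> memory \<Rightarrow> com \<Rightarrow> 'a pmf \<Rightarrow> ('a \<Rightarrow> memory \<Rightarrow> bool) \<Rightarrow> nat \<Rightarrow> bool" where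
  "triple E m c A R B \<longleftrightarrow> (\<forall>cs t q T A'. q \<le> t \<longrightarrow>
     (\<forall>x\<in>set_pmf A. \<forall>m' t' q'. R x m' \<longrightarrow> q' \<le> t' \<longrightarrow> t' \<le> t + B \<longrightarrow>
        reaches E (Config cs m' t' q') T (A' x)) \<longrightarrow>
     reaches E (Config (c # cs) m t q) T (bind_pmf A A'))"

lemma tripleI:
  assumes "\<And>cs t q T A'. q \<le> t \<Longrightarrow>
     (\<And>x m' t' q'. x \<in> set_pmf A \<Longrightarrow> R x m' \<Longrightarrow> q' \<le> t' \<Longrightarrow> t' \<le> t + B \<Longrightarrow>
        reaches E (Config cs m' t' q') T (A' x)) \<Longrightarrow>
     reaches E (Config (c # cs) m t q) T (bind_pmf A A')"
  shows "triple E m c A R B"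
  using assms unfolding triple_def by blast

lemma tripleD:
  assumes "triple E m c A R B" "q \<le> t"
    "\<And>x m' t' q'. x \<in> set_pmf A \<Longrightarrow> R x m' \<Longrightarrow> q' \<le> t' \<Longrightarrow> t' \<le> t + B \<Longrightarrow>
        reaches E (Config cs m' t' q') T (A' x)"
  shows "reaches E (Config (c # cs) m t q) T (bind_pmf A A')"
  using assms unfolding triple_def by blast

lemma triple_reaches:
  assumes "triple E m c A R B" "\<And>x m'. x \<in> set_pmf A \<Longrightarrow> R x m' \<Longrightarrow> (m' 1 0, m' 2 0) = f x"
  shows "reaches E (Config [c] m 0 0) B (map_pmf f A)"
  unfolding map_pmf_def using assms(1)
proof (rule tripleD)
  fix x m' t' q'
  assume x: "x \<in> set_pmf A" "R x m'" "q' \<le> t'" "t' \<le> 0 + B"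
  have "reaches E (Config [] m' t' q') B (return_pmf (m' 1 0, m' 2 0))"
    using x by (intro reaches_halted) auto
  then show "reaches E (Config [] m' t' q') B (return_pmf (f x))"
    using assms(2)[OF x(1,2)] by simp
qed simp

lemma triple_conseq:
  assumes "triple E m c A R B" "\<And>x m'. x \<in> set_pmf A \<Longrightarrow> R x m' \<Longrightarrow> R' x m'" "B \<le> B'"
  shows "triple E m c A R' B'"
  by (rule tripleI, rule tripleD[OF assms(1)], assumption) (use assms(2,3) in auto)

text \<open>Lets a run be reported through a function of its random value. Applied to
  \<open>return_pmf ()\<close> it gives a deterministic run a prescribed result.\<close>

lemma triple_map:
  assumes "triple E m c A (\<lambda>x. R (f x)) B"
  shows "triple E m c (map_pmf f A) R B"
  by (rule tripleI, unfold bind_map_pmf, rule tripleD[OF assms], assumption) auto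

lemma triple_Seq:
  assumes "triple E m c A R B"
    and "\<And>x m'. x \<in> set_pmf A \<Longrightarrow> R x m' \<Longrightarrow> triple E m' c' (A2 x) R2 B2"
  shows "triple E m (Seq c c') (bind_pmf A A2) R2 (1 + B + B2)"
proof (rule tripleI)
  fix cs t q T and A' :: "'b \<Rightarrow> _"
  assume q: "q \<le> t" and post: "\<And>x m' t' q'. x \<in> set_pmf (bind_pmf A A2) \<Longrightarrow> R2 x m' \<Longrightarrow> q' \<le> t' \<Longrightarrow>
        t' \<le> t + (1 + B + B2) \<Longrightarrow> reaches E (Config cs m' t' q') T (A' x)"
  have "reaches E (Config (c # c' # cs) m (t + 1) q) T (bind_pmf A (\<lambda>x. bind_pmf (A2 x) A'))"
  proof (rule tripleD[OF assms(1)])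
    fix x m' t' q'
    assume x: "x \<in> set_pmf A" "R x m'" "q' \<le> t'" "t' \<le> t + 1 + B"
    show "reaches E (Config (c' # cs) m' t' q') T (bind_pmf (A2 x) A')"
    proof (rule tripleD[OF assms(2)[OF x(1,2)] x(3)])
      fix y m2 t2 q2
      assume y: "y \<in> set_pmf (A2 x)" "R2 y m2" "q2 \<le> t2" "t2 \<le> t' + B2"
      have "y \<in> set_pmf (bind_pmf A A2)" using x(1) y(1) by auto
      from post[OF this y(2,3)] show "reaches E (Config cs m2 t2 q2) T (A' y)"
        using x(4) y(4) by simp
    qed
  qed (use q in simp)
  then show "reaches E (Config (Seq c c' # cs) m t q) T (bind_pmf (bind_pmf A A2) A')"
    by (intro reaches_return[OF step.simps(6)]) (simp add: bind_assoc_pmf)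
qed

lemma triple_Seq_return:
  assumes "triple E m c (return_pmf ()) R B"
    and "\<And>m'. R () m' \<Longrightarrow> triple E m' c' A R2 B2"
  shows "triple E m (Seq c c') A R2 (1 + B + B2)"
  using triple_Seq[OF assms(1), of c' "\<lambda>_. A" R2 B2] assms(2) by (simp add: bind_return_pmf)

lemma triple_Sample:
  "triple E m (Sample a i e) (pmf_of_set {..<max 1 (eval_expr m e)})
    (\<lambda>x m'. m' = store m a (eval_expr m i) x)
    (cost_expr m i + cost_expr m e + bits (eval_expr m i) + bits (eval_expr m e))"
proof (rule tripleI)
  fix cs t q T and A' :: "nat \<Rightarrow> _"
  let ?A = "pmf_of_set {..<max 1 (eval_expr m e)}"
  let ?t = "t + cost_expr m i + cost_expr m e + bits (eval_expr m i) + bits (eval_expr m e)"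
  let ?c = "\<lambda>x. Config cs (store m a (eval_expr m i) x) ?t q"
  have ne: "{..<max 1 (eval_expr m e)} \<noteq> {}" by (auto simp: lessThan_empty_iff)
  assume post: "q \<le> t" "\<And>x m' t' q'. x \<in> set_pmf ?A \<Longrightarrow> m' = store m a (eval_expr m i) x \<Longrightarrow> q' \<le> t' \<Longrightarrow>
    t' \<le> t + (cost_expr m i + cost_expr m e + bits (eval_expr m i) + bits (eval_expr m e)) \<Longrightarrow>
    reaches E (Config cs m' t' q') T (A' x)"
  have st: "step E (Config (Sample a i e # cs) m t q) = map_pmf ?c ?A"
    by (simp add: Let_def)
  \<comment> \<open>The rule for one step expects a continuation depending on the successor
    configuration, so the sampled value is read back from the cell just written.\<close>
  have "reaches E (Config (Sample a i e # cs) m t q) T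
    (bind_pmf (map_pmf ?c ?A) (\<lambda>c. A' (mem c a (eval_expr m i))))"
    unfolding st[symmetric]
  proof (rule reaches_bind)
    show "finite (set_pmf (step E (Config (Sample a i e # cs) m t q)))"
      unfolding st using ne by (simp add: set_pmf_of_set)
    fix c'
    assume "c' \<in> set_pmf (step E (Config (Sample a i e # cs) m t q))"
    then obtain x where x: "x \<in> set_pmf ?A" "c' = ?c x"
      unfolding st by auto
    then show "reaches E c' T (A' (mem c' a (eval_expr m i)))"
      using post(2)[OF x(1) refl, of q ?t] post(1) by (simp add: store_def)
  qed
  then show "reaches E (Config (Sample a i e # cs) m t q) T (bind_pmf ?A A')"
    by (simp add: bind_map_pmf store_def)
qed

lemma triple_While_false:
  assumes "eval_expr m b = 0"
  shows "triple E m (While b c) (return_pmf ()) (\<lambda>_ m'. m' = m) (cost_expr m b + 1)"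
  by (rule tripleI, rule reaches_return[OF step.simps(8)]) (use assms in \<open>auto simp: bind_return_pmf\<close>)

lemma triple_While_true:
  assumes "eval_expr m b \<noteq> 0" "triple E m c A R B"
    and "\<And>x m'. x \<in> set_pmf A \<Longrightarrow> R x m' \<Longrightarrow> triple E m' (While b c) (A2 x) R2 B2"
  shows "triple E m (While b c) (bind_pmf A A2) R2 (cost_expr m b + 1 + B + B2)"
proof (rule tripleI)
  fix cs t q T and A' :: "'b \<Rightarrow> _"
  assume q: "q \<le> t" and post: "\<And>x m' t' q'. x \<in> set_pmf (bind_pmf A A2) \<Longrightarrow> R2 x m' \<Longrightarrow> q' \<le> t' \<Longrightarrow>
        t' \<le> t + (cost_expr m b + 1 + B + B2) \<Longrightarrow> reaches E (Config cs m' t' q') T (A' x)"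
  have "reaches E (Config (c # While b c # cs) m (t + cost_expr m b + 1) q) T
    (bind_pmf A (\<lambda>x. bind_pmf (A2 x) A'))"
  proof (rule tripleD[OF assms(2)])
    fix x m' t' q'
    assume x: "x \<in> set_pmf A" "R x m'" "q' \<le> t'" "t' \<le> t + cost_expr m b + 1 + B"
    show "reaches E (Config (While b c # cs) m' t' q') T (bind_pmf (A2 x) A')"
    proof (rule tripleD[OF assms(3)[OF x(1,2)] x(3)])
      fix y m2 t2 q2
      assume y: "y \<in> set_pmf (A2 x)" "R2 y m2" "q2 \<le> t2" "t2 \<le> t' + B2"
      have "y \<in> set_pmf (bind_pmf A A2)" using x(1) y(1) by auto
      from post[OF this y(2,3)] show "reaches E (Config cs m2 t2 q2) T (A' y)"
        using x(4) y(4) by simp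
    qed
  qed (use q in simp)
  then show "reaches E (Config (While b c # cs) m t q) T (bind_pmf (bind_pmf A A2) A')"
    by (intro reaches_return[OF step.simps(8)]) (simp add: bind_assoc_pmf assms(1))
qed

lemma triple_While_true_return:
  assumes "eval_expr m b \<noteq> 0" "triple E m c (return_pmf ()) R B"
    and "\<And>m'. R () m' \<Longrightarrow> triple E m' (While b c) A R2 B2"
  shows "triple E m (While b c) A R2 (cost_expr m b + 1 + B + B2)"
  using triple_While_true[OF assms(1,2), of "\<lambda>_. A" R2 B2] assms(3) by (simp add: bind_return_pmf)

section \<open>Symbolic execution and cost of straight-line code\<close>

fun straight :: "com \<Rightarrow> bool" where
  "straight (Sample a i e) = False"
| "straight (While b c) = False"
| "straight (Seq c c') \<longleftrightarrow> straight c \<and> straight c'"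
| "straight (If b c c') \<longleftrightarrow> straight c \<and> straight c'"
| "straight _ = True"

fun exec :: "nat set set \<Rightarrow> com \<Rightarrow> memory \<Rightarrow> memory" where
  "exec E (Assign a i e) m = store m a (eval_expr m i) (eval_expr m e)"
| "exec E (Query a i d e) m =
    store m a (eval_expr m i) (if {eval_expr m d, eval_expr m e} \<in> E then 1 else 0)"
| "exec E (Seq c c') m = exec E c' (exec E c m)"
| "exec E (If b c c') m = (if eval_expr m b \<noteq> 0 then exec E c m else exec E c' m)"
| "exec E _ m = m"

definition mem_le :: "nat \<Rightarrow> memory \<Rightarrow> bool" where
  "mem_le W m \<longleftrightarrow> (\<forall>a i. m a i \<le> W)"

lemma mem_le_store: "mem_le W m \<Longrightarrow> x \<le> W \<Longrightarrow> mem_le W (store m a i x)"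
  by (simp add: mem_le_def store_def)

fun esize :: "expr \<Rightarrow> nat" where
  "esize (Const k) = 1"
| "esize (Read a i) = 1 + esize i"
| "esize (Bin f d e) = 1 + esize d + esize e"

text \<open>Intermediate results must be bounded as well as stored values, since every operation is
  charged the bit lengths of its operands.\<close>

fun ebounded :: "nat \<Rightarrow> memory \<Rightarrow> expr \<Rightarrow> bool" where
  "ebounded W m (Const k) \<longleftrightarrow> k \<le> W"
| "ebounded W m (Read a i) \<longleftrightarrow> ebounded W m i"
| "ebounded W m (Bin f d e) \<longleftrightarrow>
    ebounded W m d \<and> ebounded W m e \<and> apply_op f (eval_expr m d) (eval_expr m e) \<le> W"

lemma bits_mono: "x \<le> y \<Longrightarrow> bits x \<le> bits y"
  by (simp add: bits_def floor_log_le_iff)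

lemma bits_pos: "1 \<le> bits x"
  by (simp add: bits_def)

lemma ebounded_eval: "mem_le W m \<Longrightarrow> ebounded W m e \<Longrightarrow> eval_expr m e \<le> W"
  by (induction e) (auto simp: mem_le_def)

lemma ebounded_cost: "mem_le W m \<Longrightarrow> ebounded W m e \<Longrightarrow> cost_expr m e \<le> 2 * esize e * bits W"
proof (induction e)
  case (Const k)
  then show ?case using bits_mono[of k W] by simp
next
  case (Read a i)
  then show ?case
    using bits_mono[of "eval_expr m i" W] bits_mono[of "m a (eval_expr m i)" W] ebounded_eval[of W m i]
    by (simp add: mem_le_def algebra_simps)
next
  case (Bin f d e)
  then show ?case
    using bits_mono[of "eval_expr m d" W] bits_mono[of "eval_expr m e" W]
      ebounded_eval[of W m d] ebounded_eval[of W m e]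
    by (simp add: algebra_simps)
qed

fun csize :: "com \<Rightarrow> nat" where
  "csize (Assign a i e) = 2 * (esize i + esize e) + 2"
| "csize (Query a i d e) = 2 * (esize i + esize d + esize e) + 3"
| "csize (Seq c c') = 1 + csize c + csize c'"
| "csize (If b c c') = 2 * esize b + 1 + csize c + csize c'"
| "csize _ = 1"

fun cbounded :: "nat \<Rightarrow> nat set set \<Rightarrow> com \<Rightarrow> memory \<Rightarrow> bool" where
  "cbounded W E (Assign a i e) m \<longleftrightarrow> ebounded W m i \<and> ebounded W m e"
| "cbounded W E (Query a i d e) m \<longleftrightarrow> ebounded W m i \<and> ebounded W m d \<and> ebounded W m e \<and> 1 \<le> W"
| "cbounded W E (Seq c c') m \<longleftrightarrow> cbounded W E c m \<and> cbounded W E c' (exec E c m)"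
| "cbounded W E (If b c c') m \<longleftrightarrow> ebounded W m b \<and>
    (if eval_expr m b \<noteq> 0 then cbounded W E c m else cbounded W E c' m)"
| "cbounded W E _ m \<longleftrightarrow> True"

lemma exec_mem_le: "mem_le W m \<Longrightarrow> cbounded W E c m \<Longrightarrow> mem_le W (exec E c m)"
  by (induction c arbitrary: m) (auto intro!: mem_le_store ebounded_eval split: if_splits)

lemma triple_Skip: "triple E m Skip (return_pmf ()) (\<lambda>_ m'. m' = m) 1"
  by (rule tripleI, rule reaches_return[OF step.simps(2)]) (auto simp: bind_return_pmf)

lemma triple_Assign:
  "triple E m (Assign a i e) (return_pmf ()) (\<lambda>_ m'. m' = store m a (eval_expr m i) (eval_expr m e))
    (cost_expr m i + cost_expr m e + bits (eval_expr m i) + bits (eval_expr m e))"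
  by (rule tripleI, rule reaches_return[OF step.simps(3)[unfolded Let_def]]) (auto simp: bind_return_pmf)

lemma triple_Query:
  "triple E m (Query a i d e) (return_pmf ())
    (\<lambda>_ m'. m' = store m a (eval_expr m i) (if {eval_expr m d, eval_expr m e} \<in> E then 1 else 0))
    (cost_expr m i + cost_expr m d + cost_expr m e +
      bits (eval_expr m i) + bits (eval_expr m d) + bits (eval_expr m e))"
proof -
  \<comment> \<open>A query takes at least one unit of time, which preserves the invariant that
    queries never exceed time.\<close>
  have "q + 1 \<le> t + cost_expr m i + cost_expr m d + cost_expr m e +
      bits (eval_expr m i) + bits (eval_expr m d) + bits (eval_expr m e)" if "q \<le> t" for q t
    using that bits_pos[of "eval_expr m i"] by simp
  then show ?thesis
    by (intro tripleI, intro reaches_return[OF step.simps(5)[unfolded Let_def]])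
      (auto simp: bind_return_pmf)
qed

lemma triple_If:
  assumes "triple E m (if eval_expr m b \<noteq> 0 then c else c') A R B"
  shows "triple E m (If b c c') A R (cost_expr m b + 1 + B)"
  by (rule tripleI, rule reaches_return[OF step.simps(7)], rule tripleD[OF assms]) auto

text \<open>Reduces a deterministic loop-free block to two computations by rewriting: its final
  memory \<open>exec\<close> and the bound check \<open>cbounded\<close>. The cost is a constant of
  the program text times one bit length.\<close>

lemma triple_straight:
  assumes "straight c" "mem_le W m" "cbounded W E c m"
  shows "triple E m c (return_pmf ()) (\<lambda>_ m'. m' = exec E c m \<and> mem_le W m') (csize c * bits W)"
  using assms
proof (induction c arbitrary: m)
  case Skip
  then show ?case
    by (intro triple_conseq[OF triple_Skip]) (use bits_pos in auto)
next
  case (Assign a i e)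
  have "cost_expr m i + cost_expr m e + bits (eval_expr m i) + bits (eval_expr m e)
      \<le> csize (Assign a i e) * bits W"
    using Assign ebounded_cost[of W m i] ebounded_cost[of W m e]
      bits_mono[of "eval_expr m i" W] bits_mono[of "eval_expr m e" W]
      ebounded_eval[of W m i] ebounded_eval[of W m e]
    by (simp add: algebra_simps)
  with Assign exec_mem_le[of W m E "Assign a i e"] show ?case
    by (intro triple_conseq[OF triple_Assign]) auto
next
  case (Query a i d e)
  have "cost_expr m i + cost_expr m d + cost_expr m e +
      bits (eval_expr m i) + bits (eval_expr m d) + bits (eval_expr m e)
      \<le> csize (Query a i d e) * bits W"
    using Query ebounded_cost[of W m i] ebounded_cost[of W m d] ebounded_cost[of W m e]
      bits_mono[of "eval_expr m i" W] bits_mono[of "eval_expr m d" W] bits_mono[of "eval_expr m e" W]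
      ebounded_eval[of W m i] ebounded_eval[of W m d] ebounded_eval[of W m e]
    by (simp add: algebra_simps)
  with Query exec_mem_le[of W m E "Query a i d e"] show ?case
    by (intro triple_conseq[OF triple_Query]) auto
next
  case (Seq c1 c2)
  have "triple E m (Seq c1 c2) (return_pmf ())
      (\<lambda>_ m'. m' = exec E c2 (exec E c1 m) \<and> mem_le W m') (1 + csize c1 * bits W + csize c2 * bits W)"
    using Seq by (intro triple_Seq_return[OF Seq.IH(1)]) auto
  then show ?case
    using bits_pos[of W] by (rule_tac triple_conseq) (auto simp: algebra_simps)
next
  case (If b c1 c2)
  have "triple E m (if eval_expr m b \<noteq> 0 then c1 else c2) (return_pmf ())
    (\<lambda>_ m'. m' = exec E (If b c1 c2) m \<and> mem_le W m') ((csize c1 + csize c2) * bits W)"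
  proof (cases "eval_expr m b \<noteq> 0")
    case True
    then show ?thesis
      using If by (auto intro!: triple_conseq[OF If.IH(1)] simp: algebra_simps)
  next
    case False
    then show ?thesis
      using If by (auto intro!: triple_conseq[OF If.IH(2)] simp: algebra_simps)
  qed
  moreover have "cost_expr m b + 1 \<le> (2 * esize b + 1) * bits W"
    using ebounded_cost[of W m b] If bits_pos[of W] by simp
  ultimately show ?case
    by (intro triple_conseq[OF triple_If]) (auto simp: algebra_simps)
qed auto

section \<open>The algorithm\<close>

text \<open>
  Scalars are stored in entry 0 of an array: 0 the number of vertices, 1 and 2 the outputs, 3 the
  reciprocal accuracy \<open>Q\<close>, 4 and 5 the argument and result of the logarithm, 6 the number of trials,
  7 the trials left, 8 the number of successful trials, 9 and 10 the indices of the shuffle, 12 the height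
  of the stack, 15 the steps left, 16 the answer to a query, 17 the queried vertex. Array 11 holds
  the random order, and arrays 13 and 14 the vertices and rounds on the stack, from entry 1 on;
  entry 0 of array 14 is a sentinel.
\<close>

abbreviation var :: "nat \<Rightarrow> expr" where
  "var k \<equiv> Read k (Const 0)"

abbreviation assign :: "nat \<Rightarrow> expr \<Rightarrow> com" where
  "assign k e \<equiv> Assign k (Const 0) e"

text \<open>Program for one step of \<open>advance\<close>. Thanks to the sentinel, the limit of the
  top entry is always the neighbouring cell of array 14. The second assignment to array 17 reduces
  modulo \<open>n\<close> by subtracting the quotient times \<open>n\<close>. At a final stack the
  answer is added to the counter and the height is reset to 0, which stops the loop.\<close>

definition explore_body :: com where
  "explore_body =
    Seq (assign 15 (Bin Minus (var 15) (Const 1)))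
    (If (Bin Less (Read 14 (var 12)) (Read 14 (Bin Minus (var 12) (Const 1))))
      (Seq (assign 17 (Bin Plus (Read 11 (Read 14 (var 12))) (Bin Minus (var 0) (Read 13 (var 12)))))
      (Seq (assign 17 (Bin Minus (var 17) (Bin Times (Bin Divide (var 17) (var 0)) (var 0))))
      (Seq (Query 16 (Const 0) (Read 13 (var 12)) (var 17))
        (If (var 16)
          (Seq (assign 12 (Bin Plus (var 12) (Const 1)))
          (Seq (Assign 13 (var 12) (var 17))
            (Assign 14 (var 12) (Const 0))))
          (Assign 14 (var 12) (Bin Plus (Read 14 (var 12)) (Const 1)))))))
      (If (Bin Less (Const 2) (var 12))
        (Seq (assign 12 (Bin Minus (var 12) (Const 2)))
          (Assign 14 (var 12) (Bin Plus (Read 14 (var 12)) (Const 1))))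
        (Seq (assign 8 (Bin Plus (var 8) (Bin Minus (var 12) (Const 1))))
          (assign 12 (Const 0)))))"

text \<open>The product acts as a conjunction: the stack has not been cleared and steps are left.
  Its value is the reason why \<open>W\<close> has to bound the stack height times the number of
  steps.\<close>

definition explore_loop :: com where
  "explore_loop = While (Bin Times (var 12) (var 15)) explore_body"

lemma straight_explore_body: "straight explore_body"
  by (simp add: explore_body_def)

fun represents :: "nat \<Rightarrow> memory \<Rightarrow> (nat \<times> nat) list \<Rightarrow> bool" where
  "represents n m [] \<longleftrightarrow> m 14 0 = n"
| "represents n m ((a, x) # st) \<longleftrightarrow>
    m 13 (Suc (length st)) = a \<and> m 14 (Suc (length st)) = x \<and> represents n m st"

lemma represents_cong:
  "(\<And>i. i \<le> length st \<Longrightarrow> m' 13 i = m 13 i \<and> m' 14 i = m 14 i) \<Longrightarrow>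
    represents n m st \<Longrightarrow> represents n m' st"
  by (induction n m st rule: represents.induct) auto

lemma represents_limit: "represents n m st \<Longrightarrow> m 14 (length st) = limit n st"
  by (cases st) auto

lemma partner_expr: "a \<le> n \<Longrightarrow> (c + (n - a)) - (c + (n - a)) div n * n = partner n c a"
  by (simp add: partner_def minus_div_mult_eq_mod)

lemma store_apply: "store m a i x b j = (if b = a \<and> j = i then x else m b j)"
  by (simp add: store_def)

text \<open>Simulation of \<open>advance\<close> on the array representation. The bound
  \<open>2 * n + 2\<close> covers the unreduced sum \<open>s x + (n - a)\<close> and the height
  after a push; \<open>m 8 0 < W\<close> leaves room for one success.\<close>

lemma explore_body_exec:
  assumes s: "s permutes {..<n}" and w: "wf_stack n E s st" "st \<noteq> []"
    and m: "m 0 0 = n" "\<forall>i<n. m 11 i = s i" "represents n m st" "m 12 0 = length st" "mem_le W m"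
    and W: "2 * n + 2 \<le> W" "m 8 0 < W"
  defines "m' \<equiv> exec E explore_body m"
  shows "cbounded W E explore_body m"
    and "m' 15 0 = m 15 0 - 1"
    and "a \<in> {0, 3, 6, 7, 11} \<Longrightarrow> m' a i = m a i"
    and "final n st \<Longrightarrow> m' 12 0 = 0 \<and> m' 8 0 = m 8 0 + (length st - 1)"
    and "\<not> final n st \<Longrightarrow>
      m' 12 0 = length (advance n E s st) \<and> m' 8 0 = m 8 0 \<and> represents n m' (advance n E s st)"
proof -
  obtain a x st' where st: "st = (a, x) # st'" using w(2) by (cases st) auto
  have a: "a < n" "m 13 (Suc (length st')) = a" "m 14 (Suc (length st')) = x" "represents n m st'"
    "m 14 (length st') = limit n st'" "x \<le> limit n st'" "limit n st' \<le> n" "length st' \<le> n"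
    using w m(3) represents_limit[of n m st'] limit_le[of n E s st'] wf_stack_length[OF w(1)]
    by (auto simp: st)
  have mW: "m b j \<le> W" for b j using m(5) by (simp add: mem_le_def)
  have mW': "m b j - Suc 0 \<le> W" for b j using mW[of b j] by simp
  have d: "m 12 0 = Suc (length st')" using m(4) by (simp add: st)
  have all: "cbounded W E explore_body m \<and> m' 15 0 = m 15 0 - 1 \<and>
    (\<forall>a\<in>{0, 3, 6, 7, 11}. \<forall>i. m' a i = m a i) \<and>
    (final n st \<longrightarrow> m' 12 0 = 0 \<and> m' 8 0 = m 8 0 + (length st - 1)) \<and>
    (\<not> final n st \<longrightarrow>
      m' 12 0 = length (advance n E s st) \<and> m' 8 0 = m 8 0 \<and> represents n m' (advance n E s st))"
  proof (cases "x < limit n st'")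
    case True
    then have "x < n" using a by simp
    then have sx: "m 11 x = s x" "s x < n"
      using m(2) permutes_in_image[OF s, of x] by auto
    let ?p = "partner n (s x) a"
    have nf: "\<not> final n st" using True by (simp add: final_def active_def st)
    have p: "?p < n" using a(1) by (simp add: partner_less)
    have pe: "s x + (n - a) - (s x + (n - a)) div n * n = ?p"
      using a(1) by (intro partner_expr) auto
    have y: "s x + (n - a) \<le> W" "(s x + (n - a)) div n * n \<le> W"  "(s x + (n - a)) div n \<le> W"
      "Suc (Suc (length st')) \<le> W" "Suc x \<le> W" "1 \<le> W" "n - a \<le> W" "?p \<le> W"
      using sx W(1) a(8) \<open>x < n\<close> p
        div_times_less_eq_dividend[of "s x + (n - a)" n] div_le_dividend[of "s x + (n - a)" n]
      by linarith+
    show ?thesis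
    proof (cases "{a, ?p} \<in> E")
      case edge: True
      have adv: "advance n E s st = (?p, 0) # st" using True edge by (simp add: st)
      have m': "m' = store (store (store (store (store (store (store m 15 0 (m 15 0 - 1))
          17 0 (s x + (n - a))) 17 0 ?p) 16 0 1) 12 0 (Suc (Suc (length st'))))
          13 (Suc (Suc (length st'))) ?p) 14 (Suc (Suc (length st'))) 0"
        using True edge by (simp add: m'_def explore_body_def store_apply a d m(1) sx pe)
      have "represents n m' st'"
        by (rule represents_cong[OF _ a(4)]) (simp add: m' store_apply)
      then have "represents n m' (advance n E s st)"
        unfolding adv using a by (simp add: m' store_apply st)
      moreover have "cbounded W E explore_body m"
        using True edge y mW mW' W
        by (simp add: explore_body_def store_apply a d m(1) sx pe diff_le_mono)
      ultimately show ?thesis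
        unfolding adv using nf by (auto simp: m' store_apply st)
    next
      case edge: False
      have adv: "advance n E s st = (a, Suc x) # st'" using True edge by (simp add: st)
      have m': "m' = store (store (store (store (store m 15 0 (m 15 0 - 1))
          17 0 (s x + (n - a))) 17 0 ?p) 16 0 0) 14 (Suc (length st')) (Suc x)"
        using True edge by (simp add: m'_def explore_body_def store_apply a d m(1) sx pe)
      have "represents n m' st'"
        by (rule represents_cong[OF _ a(4)]) (simp add: m' store_apply)
      then have "represents n m' (advance n E s st)"
        unfolding adv using a by (simp add: m' store_apply st)
      moreover have "cbounded W E explore_body m"
        using True edge y mW mW' W
        by (simp add: explore_body_def store_apply a d m(1) sx pe)
      ultimately show ?thesis
        unfolding adv using nf by (auto simp: m' store_apply st d)
    qed
  next
    case False
    show ?thesis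
    proof (cases "length st \<le> 2")
      case True
      then have f: "final n st" using False by (simp add: final_def active_def st)
      have m': "m' = store (store (store m 15 0 (m 15 0 - 1)) 8 0 (m 8 0 + length st')) 12 0 0"
        using True False by (simp add: m'_def explore_body_def store_apply a d m(1) st)
      have "cbounded W E explore_body m"
        using True False mW mW' W a(8) by (simp add: explore_body_def store_apply a d m(1) st)
      then show ?thesis
        using f by (auto simp: m' store_apply st)
    next
      case len: False
      then have f: "\<not> final n st" by (simp add: final_def)
      from len obtain c z b y st2 where st': "st' = (c, z) # (b, y) # st2"
        unfolding st by (cases st'; cases "tl st'") auto
      have adv: "advance n E s st = (b, Suc y) # st2"
        using False by (simp add: st st')
      have b: "m 13 (Suc (length st2)) = b" "m 14 (Suc (length st2)) = y" "represents n m st2"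
        "y \<le> n"
        using m(3) w limit_le[of n E s st2] by (auto simp: st st')
      have m': "m' = store (store (store m 15 0 (m 15 0 - 1)) 12 0 (Suc (length st2)))
          14 (Suc (length st2)) (Suc y)"
        using False a b by (simp add: m'_def explore_body_def store_apply d st')
      have "represents n m' st2"
        by (rule represents_cong[OF _ b(3)]) (simp add: m' store_apply)
      then have "represents n m' (advance n E s st)"
        unfolding adv using b by (simp add: m' store_apply)
      moreover have "cbounded W E explore_body m"
        using False mW mW' W a b by (simp add: explore_body_def store_apply d st')
      ultimately show ?thesis
        unfolding adv using f by (auto simp: m' store_apply)
    qed
  qed
  then show "cbounded W E explore_body m" "m' 15 0 = m 15 0 - 1"
    "a \<in> {0, 3, 6, 7, 11} \<Longrightarrow> m' a i = m a i"
    "final n st \<Longrightarrow> m' 12 0 = 0 \<and> m' 8 0 = m 8 0 + (length st - 1)"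
    "\<not> final n st \<Longrightarrow>
      m' 12 0 = length (advance n E s st) \<and> m' 8 0 = m 8 0 \<and> represents n m' (advance n E s st)" for a i
    by blast+
qed


text \<open>A loop test costs at most \<open>11 * bits W\<close>. Each pass is charged two of them,
  which also pays for the test that ends the loop.\<close>

lemma triple_explore_loop:
  assumes s: "s permutes {..<n}" and w: "wf_stack n E s st" "st \<noteq> []"
    and m: "m 0 0 = n" "\<forall>i<n. m 11 i = s i" "represents n m st" "m 12 0 = length st"
      "m 15 0 = b" "mem_le W m"
    and W: "2 * n + 2 \<le> W" "m 8 0 < W" "Suc n * b \<le> W"
  shows "triple E m explore_loop (return_pmf ())
    (\<lambda>_ m'. m' 8 0 = m 8 0 + explore n E s b st \<and> mem_le W m' \<and> (\<forall>a\<in>{0, 3, 6, 7}. m' a 0 = m a 0))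
    (Suc b * (csize explore_body + 22) * bits W)"
  using assms(2-)
proof (induction b arbitrary: m st)
  case 0
  have "cost_expr m (Bin Times (var 12) (var 15)) + 1 \<le> (csize explore_body + 22) * bits W"
    using ebounded_cost[of W m "Bin Times (var 12) (var 15)"] 0 bits_pos[of W]
    by (simp add: algebra_simps)
  then show ?case
    unfolding explore_loop_def
    by (intro triple_conseq[OF triple_While_false]) (use 0 in auto)
next
  case (Suc b)
  let ?c = "Bin Times (var 12) (var 15)"
  let ?m = "exec E explore_body m"
  note body = explore_body_exec[OF s Suc.prems(1-6,8-10)]
  have W1: "1 \<le> W" using Suc.prems by simp
  have "length st * Suc b \<le> Suc n * Suc b"
    using wf_stack_length[OF Suc.prems(1)] by (intro mult_right_mono) auto
  then have "length st * Suc b \<le> W"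
    using Suc.prems(11) by simp
  then have cost: "cost_expr m ?c + 1 \<le> 11 * bits W"
    using ebounded_cost[of W m ?c] Suc.prems bits_pos[of W]
    by simp
  have tb: "triple E m explore_body (return_pmf ()) (\<lambda>_ m'. m' = ?m \<and> mem_le W m') (csize explore_body * bits W)"
    by (rule triple_straight[OF straight_explore_body Suc.prems(8) body(1)])
  have nz: "eval_expr m ?c \<noteq> 0"
    using Suc.prems by simp
  show ?case
  proof (cases "final n st")
    case True
    have "triple E m (While ?c explore_body) (return_pmf ())
      (\<lambda>_ m'. m' = ?m \<and> mem_le W m') (cost_expr m ?c + 1 + csize explore_body * bits W + 11 * bits W)"
    proof (rule triple_While_true_return[OF nz tb])
      fix m'
      assume m': "m' = ?m \<and> mem_le W m'"
      have z: "m' 12 0 = 0" using body(4) True m' by simp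
      then have z': "eval_expr m' ?c = 0" by simp
      have "cost_expr m' ?c + 1 \<le> 11 * bits W"
        using ebounded_cost[OF conjunct2[OF m'], of ?c] z bits_pos[of W] by simp
      then show "triple E m' (While ?c explore_body) (return_pmf ()) (\<lambda>_ m'. m' = ?m \<and> mem_le W m') (11 * bits W)"
        using m' by (intro triple_conseq[OF triple_While_false[OF z']]) auto
    qed
    then show ?thesis
      unfolding explore_loop_def
    proof (rule triple_conseq)
      show "cost_expr m ?c + 1 + csize explore_body * bits W + 11 * bits W
        \<le> Suc (Suc b) * (csize explore_body + 22) * bits W"
        using cost by (simp add: algebra_simps)
    qed (use body True in auto)
  next
    case False
    note adv = advance_wf[OF Suc.prems(1,2) False] and ex = body(5)[OF False]
    have "triple E m explore_loop (return_pmf ())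
      (\<lambda>_ m'. m' 8 0 = m 8 0 + explore n E s (Suc b) st \<and> mem_le W m' \<and> (\<forall>a\<in>{0, 3, 6, 7}. m' a 0 = m a 0))
      (cost_expr m ?c + 1 + csize explore_body * bits W + Suc b * (csize explore_body + 22) * bits W)"
      unfolding explore_loop_def
    proof (rule triple_While_true_return[OF nz tb], fold explore_loop_def)
      fix m'
      assume m': "m' = ?m \<and> mem_le W m'"
      have "triple E m' explore_loop (return_pmf ())
        (\<lambda>_ m2. m2 8 0 = m' 8 0 + explore n E s b (advance n E s st) \<and> mem_le W m2 \<and>
          (\<forall>a\<in>{0, 3, 6, 7}. m2 a 0 = m' a 0)) (Suc b * (csize explore_body + 22) * bits W)"
        using m' adv ex body(2,3) Suc.prems by (intro Suc.IH) (auto simp: mult_Suc_right)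
      then show "triple E m' explore_loop (return_pmf ())
        (\<lambda>_ m2. m2 8 0 = m 8 0 + explore n E s (Suc b) st \<and> mem_le W m2 \<and>
          (\<forall>a\<in>{0, 3, 6, 7}. m2 a 0 = m a 0)) (Suc b * (csize explore_body + 22) * bits W)"
        by (rule triple_conseq) (use m' ex body(3) False in auto)
    qed
    then show ?thesis
      by (rule triple_conseq) (use cost in \<open>auto simp: algebra_simps\<close>)
  qed
qed

section \<open>Uniformly random orders\<close>

lemma triple_Sample_bounded:
  assumes "mem_le W m" "ebounded W m i" "ebounded W m e"
  shows "triple E m (Sample a i e) (pmf_of_set {..<max 1 (eval_expr m e)})
    (\<lambda>x m'. m' = store m a (eval_expr m i) x \<and> mem_le W m') ((2 * (esize i + esize e) + 2) * bits W)"
proof (rule triple_conseq[OF triple_Sample])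
  fix x m'
  have ne: "{..<max 1 (eval_expr m e)} \<noteq> {}" by (auto simp: lessThan_empty_iff)
  assume "x \<in> set_pmf (pmf_of_set {..<max 1 (eval_expr m e)})" "m' = store m a (eval_expr m i) x"
  moreover from this have "x < max 1 (eval_expr m e)"
    using ne by (simp add: set_pmf_of_set)
  then have "x \<le> W"
    using ebounded_eval[OF assms(1,3)] by (simp add: max_def split: if_splits)
  ultimately show "m' = store m a (eval_expr m i) x \<and> mem_le W m'"
    using assms(1) by (simp add: mem_le_store)
next
  show "cost_expr m i + cost_expr m e + bits (eval_expr m i) + bits (eval_expr m e)
    \<le> (2 * (esize i + esize e) + 2) * bits W"
    using ebounded_cost[OF assms(1,2)] ebounded_cost[OF assms(1,3)]
      bits_mono[OF ebounded_eval[OF assms(1,2)]] bits_mono[OF ebounded_eval[OF assms(1,3)]]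
    by (simp add: algebra_simps)
qed

text \<open>A random command followed by a deterministic one: the value drawn by the first remains
  the index of the final postcondition.\<close>

lemma triple_Seq_keep:
  assumes "triple E m c A R B"
    and "\<And>x m'. x \<in> set_pmf A \<Longrightarrow> R x m' \<Longrightarrow> triple E m' c' (return_pmf ()) (\<lambda>_. R2 x) B2"
  shows "triple E m (Seq c c') A R2 (1 + B + B2)"
proof -
  have "triple E m (Seq c c') (bind_pmf A (\<lambda>x. map_pmf (\<lambda>_. x) (return_pmf ()))) R2 (1 + B + B2)"
    by (rule triple_Seq[OF assms(1)], rule triple_map) (rule assms(2))
  then show ?thesis by (simp add: bind_return_pmf')
qed

text \<open>The shuffle that builds the permutation place by place. As \<open>p\<close> fixes
  \<open>i\<close>, the composition moves the old value at place \<open>j\<close> to place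
  \<open>i\<close> and puts \<open>i\<close> at place \<open>j\<close>.\<close>

fun shuffle :: "nat \<Rightarrow> nat \<Rightarrow> (nat \<Rightarrow> nat) \<Rightarrow> (nat \<Rightarrow> nat) pmf" where
  "shuffle 0 i p = return_pmf p"
| "shuffle (Suc k) i p = bind_pmf (pmf_of_set {..<Suc i}) (\<lambda>j. shuffle k (Suc i) (p \<circ> Transposition.transpose i j))"

lemma permutes_transpose_Suc:
  assumes "p permutes {..<i}" "j < Suc i"
  shows "p \<circ> Transposition.transpose i j permutes {..<Suc i}"
proof (rule permutes_compose)
  show "Transposition.transpose i j permutes {..<Suc i}"
    using assms(2) by (intro permutes_swap_id) auto
  show "p permutes {..<Suc i}"
    using assms(1) by (rule permutes_subset) auto
qed

text \<open>The index \<open>j\<close> is recovered as the place of the value \<open>i\<close>, and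
  then \<open>p\<close> by undoing the transposition. Surjectivity follows by comparing
  cardinalities.\<close>

lemma bij_betw_transpose_perms:
  "bij_betw (\<lambda>(p, j). p \<circ> Transposition.transpose i j) (perms i \<times> {..<Suc i}) (perms (Suc i))"
proof -
  let ?f = "\<lambda>(p, j). p \<circ> Transposition.transpose i j"
  have fix_i: "(p \<circ> Transposition.transpose i j) j = i" if "p \<in> perms i" for p j
    using that by (simp add: permutes_not_in)
  have inj: "inj_on ?f (perms i \<times> {..<Suc i})"
  proof (rule inj_onI, clarify)
    fix p j q k
    assume p: "p permutes {..<i}" and q: "q permutes {..<i}" and eq: "p \<circ> Transposition.transpose i j = q \<circ> Transposition.transpose i k"
    have "bij (p \<circ> Transposition.transpose i j)"
      using permutes_bij[OF p] by (intro bij_comp bij_swap) auto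
    moreover have "(p \<circ> Transposition.transpose i j) j = (p \<circ> Transposition.transpose i j) k"
      using fix_i[of p j] fix_i[of q k] p q unfolding eq by simp
    ultimately have jk: "j = k" by (blast dest: bij_is_inj injD)
    have "p = q"
    proof
      fix y
      show "p y = q y"
        using fun_cong[OF eq, of "Transposition.transpose i j y"] by (simp add: jk)
    qed
    with jk show "p = q \<and> j = k" by blast
  qed
  have "?f ` (perms i \<times> {..<Suc i}) \<subseteq> perms (Suc i)"
    using permutes_transpose_Suc by auto
  moreover have "card (?f ` (perms i \<times> {..<Suc i})) = card (perms (Suc i))"
    unfolding card_image[OF inj] by (simp add: card_cartesian_product card_perms)
  ultimately have "?f ` (perms i \<times> {..<Suc i}) = perms (Suc i)"
    by (intro card_subset_eq finite_perms)
  with inj show ?thesis by (simp add: bij_betw_def)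
qed

lemma pmf_of_set_bind_Times:
  assumes "finite A" "A \<noteq> {}" "finite B" "B \<noteq> {}"
  shows "bind_pmf (pmf_of_set A) (\<lambda>x. bind_pmf (pmf_of_set B) (\<lambda>y. f x y)) =
    bind_pmf (pmf_of_set (A \<times> B)) (\<lambda>(x, y). f x y)"
proof -
  have "pmf_of_set (A \<times> B) = pair_pmf (pmf_of_set A) (pmf_of_set B)"
  proof (rule pmf_eqI)
    fix z :: "'a \<times> 'b"
    obtain a b where z: "z = (a, b)" by force
    have "A \<times> B \<noteq> {}" using assms by simp
    then show "pmf (pmf_of_set (A \<times> B)) z = pmf (pair_pmf (pmf_of_set A) (pmf_of_set B)) z"
      unfolding z pmf_pair using assms(1,3)
      by (simp only: pmf_of_set[OF assms(2,1)] pmf_of_set[OF assms(4,3)] pmf_of_set finite_cartesian_product)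
        (simp add: card_cartesian_product indicator_def)
  qed
  then show ?thesis
    by (simp add: pair_pmf_def bind_assoc_pmf bind_return_pmf)
qed

lemma perms_nonempty: "perms i \<noteq> {}"
  using permutes_id by blast

lemma shuffle_uniform:
  "bind_pmf (pmf_of_set (perms i)) (shuffle k i) = pmf_of_set (perms (i + k))"
proof (induction k arbitrary: i)
  case 0
  then show ?case by (simp add: bind_return_pmf' cong: bind_pmf_cong)
next
  case (Suc k)
  have "bind_pmf (pmf_of_set (perms i)) (shuffle (Suc k) i) =
      bind_pmf (pmf_of_set (perms i \<times> {..<Suc i})) (\<lambda>(p, j). shuffle k (Suc i) (p \<circ> Transposition.transpose i j))"
    unfolding shuffle.simps
    using perms_nonempty by (intro pmf_of_set_bind_Times finite_perms) auto
  also have "\<dots> = bind_pmf (map_pmf (\<lambda>(p, j). p \<circ> Transposition.transpose i j) (pmf_of_set (perms i \<times> {..<Suc i})))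
      (shuffle k (Suc i))"
    by (simp add: bind_map_pmf case_prod_unfold)
  also have "map_pmf (\<lambda>(p, j). p \<circ> Transposition.transpose i j) (pmf_of_set (perms i \<times> {..<Suc i})) = pmf_of_set (perms (Suc i))"
    using perms_nonempty finite_perms[of i]
    by (intro map_pmf_of_set_bij_betw bij_betw_transpose_perms) auto
  finally show ?case using Suc.IH[of "Suc i"] by simp
qed

definition shuffle_body :: com where
  "shuffle_body =
    Seq (Sample 10 (Const 0) (Bin Plus (var 9) (Const 1)))
    (Seq (Assign 11 (var 9) (Read 11 (var 10)))
    (Seq (Assign 11 (var 10) (var 9))
      (assign 9 (Bin Plus (var 9) (Const 1)))))"

definition shuffle_loop :: com where
  "shuffle_loop = While (Bin Less (var 9) (var 0)) shuffle_body"

text \<open>Only the places below \<open>i\<close> are assumed to be correct, since later ones may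
  hold remains of an earlier trial. If \<open>j = i\<close>, such a remainder is copied onto itself
  and then overwritten.\<close>

lemma triple_shuffle_body:
  assumes m: "m 0 0 = n" "m 9 0 = i" "i < n" "mem_le W m" "\<forall>j<i. m 11 j = p j"
    and p: "p permutes {..<i}" and W: "n < W"
  shows "triple E m shuffle_body (pmf_of_set {..<Suc i})
    (\<lambda>j m'. m' 9 0 = Suc i \<and> mem_le W m' \<and> (\<forall>j'<Suc i. m' 11 j' = (p \<circ> Transposition.transpose i j) j') \<and>
      (\<forall>a\<in>{0, 3, 6, 7, 8}. m' a 0 = m a 0)) (50 * bits W)"
proof -
  let ?rest = "Seq (Assign 11 (var 9) (Read 11 (var 10)))
    (Seq (Assign 11 (var 10) (var 9)) (assign 9 (Bin Plus (var 9) (Const 1))))"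
  have "triple E m shuffle_body (pmf_of_set {..<max 1 (eval_expr m (Bin Plus (var 9) (Const 1)))})
    (\<lambda>j m'. m' = exec E ?rest (store m 10 0 j) \<and> mem_le W m')
    (1 + (2 * (esize (Const 0) + esize (Bin Plus (var 9) (Const 1))) + 2) * bits W + csize ?rest * bits W)"
    unfolding shuffle_body_def
  proof (rule triple_Seq_keep[OF triple_Sample_bounded])
    show "ebounded W m (Bin Plus (var 9) (Const 1))" using m W by simp
    fix j m'
    assume *: "m' = store m 10 (eval_expr m (Const 0)) j \<and> mem_le W m'"
    then have eq: "store m 10 0 j = m'" by simp
    show "triple E m' ?rest (return_pmf ()) (\<lambda>_ m'. m' = exec E ?rest (store m 10 0 j) \<and> mem_le W m')
        (csize ?rest * bits W)"
      unfolding eq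
      by (rule triple_straight) (use m W * in \<open>auto simp: store_apply\<close>)
  qed (use m in auto)
  then have "triple E m shuffle_body (pmf_of_set {..<Suc i})
    (\<lambda>j m'. m' = exec E ?rest (store m 10 0 j) \<and> mem_le W m')
    (1 + (2 * (esize (Const 0) + esize (Bin Plus (var 9) (Const 1))) + 2) * bits W + csize ?rest * bits W)"
    using m by simp
  then show ?thesis
  proof (rule triple_conseq)
    fix j m'
    assume "j \<in> set_pmf (pmf_of_set {..<Suc i})" and m': "m' = exec E ?rest (store m 10 0 j) \<and> mem_le W m'"
    then have j: "j \<le> i" by (simp add: set_pmf_of_set lessThan_empty_iff)
    have "p i = i" using p by (simp add: permutes_not_in)
    then have "m' 11 j' = (p \<circ> Transposition.transpose i j) j'" if "j' < Suc i" for j'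
      using m' m j that by (auto simp: store_apply Transposition.transpose_def less_Suc_eq)
    then show "m' 9 0 = Suc i \<and> mem_le W m' \<and> (\<forall>j'<Suc i. m' 11 j' = (p \<circ> Transposition.transpose i j) j') \<and>
      (\<forall>a\<in>{0, 3, 6, 7, 8}. m' a 0 = m a 0)"
      using m' m by (auto simp: store_apply)
  qed (use bits_pos[of W] in simp)
qed

lemma triple_shuffle_loop:
  assumes "m 0 0 = n" "m 9 0 = i" "i + k = n" "mem_le W m" "\<forall>j<i. m 11 j = p j"
    and "p permutes {..<i}" and W: "n < W"
  shows "triple E m shuffle_loop (shuffle k i p)
    (\<lambda>s m'. mem_le W m' \<and> (\<forall>j<n. m' 11 j = s j) \<and> (\<forall>a\<in>{0, 3, 6, 7, 8}. m' a 0 = m a 0))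
    (Suc k * 61 * bits W)"
  using assms(1-6)
proof (induction k arbitrary: m i p)
  case 0
  have "cost_expr m (Bin Less (var 9) (var 0)) + 1 \<le> 61 * bits W"
    using ebounded_cost[of W m "Bin Less (var 9) (var 0)"] 0 bits_pos[of W] by simp
  moreover have *: "triple E m shuffle_loop (map_pmf (\<lambda>_. p) (return_pmf ()))
    (\<lambda>s m'. mem_le W m' \<and> (\<forall>j<n. m' 11 j = s j) \<and> (\<forall>a\<in>{0, 3, 6, 7, 8}. m' a 0 = m a 0))
    (cost_expr m (Bin Less (var 9) (var 0)) + 1)"
    unfolding shuffle_loop_def
    by (intro triple_map triple_conseq[OF triple_While_false]) (use 0 in auto)
  ultimately show ?case
    using triple_conseq[OF *] by simp
next
  case (Suc k)
  let ?c = "Bin Less (var 9) (var 0)"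
  have i: "i < n" using Suc.prems by simp
  have W1: "1 \<le> W" using W by simp
  have cost: "cost_expr m ?c + 1 \<le> 11 * bits W"
    using ebounded_cost[of W m ?c] Suc.prems bits_pos[of W] i W1 by simp
  have "triple E m shuffle_loop (shuffle (Suc k) i p)
    (\<lambda>s m'. mem_le W m' \<and> (\<forall>j<n. m' 11 j = s j) \<and> (\<forall>a\<in>{0, 3, 6, 7, 8}. m' a 0 = m a 0))
    (cost_expr m ?c + 1 + 50 * bits W + Suc k * 61 * bits W)"
    unfolding shuffle_loop_def shuffle.simps
  proof (rule triple_While_true[OF _ triple_shuffle_body[OF Suc.prems(1,2) i Suc.prems(4-6) W]],
      fold shuffle_loop_def)
    fix j m'
    assume j: "j \<in> set_pmf (pmf_of_set {..<Suc i})" and m': "m' 9 0 = Suc i \<and> mem_le W m' \<and>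
      (\<forall>j'<Suc i. m' 11 j' = (p \<circ> Transposition.transpose i j) j') \<and> (\<forall>a\<in>{0, 3, 6, 7, 8}. m' a 0 = m a 0)"
    have "j < Suc i" using j by (simp add: set_pmf_of_set lessThan_empty_iff)
    then have perm: "p \<circ> Transposition.transpose i j permutes {..<Suc i}"
      using Suc.prems(6) permutes_transpose_Suc by blast
    have "triple E m' shuffle_loop (shuffle k (Suc i) (p \<circ> Transposition.transpose i j))
      (\<lambda>s m2. mem_le W m2 \<and> (\<forall>j<n. m2 11 j = s j) \<and> (\<forall>a\<in>{0, 3, 6, 7, 8}. m2 a 0 = m' a 0))
      (Suc k * 61 * bits W)"
      using m' Suc.prems by (intro Suc.IH perm) auto
    then show "triple E m' shuffle_loop (shuffle k (Suc i) (p \<circ> Transposition.transpose i j))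
      (\<lambda>s m2. mem_le W m2 \<and> (\<forall>j<n. m2 11 j = s j) \<and> (\<forall>a\<in>{0, 3, 6, 7, 8}. m2 a 0 = m a 0))
      (Suc k * 61 * bits W)"
      by (rule triple_conseq) (use m' in auto)
  qed (use Suc.prems i in simp)
  then show ?case
    by (rule triple_conseq) (use cost in \<open>auto simp: algebra_simps\<close>)
qed

section \<open>One trial as a Bernoulli experiment\<close>

definition start :: com where
  "start =
    Seq (Assign 14 (Const 0) (var 0))
    (Seq (Assign 14 (Const 1) (Const 0))
    (Seq (assign 12 (Const 1))
      (assign 15 (Bin Times (Const 12) (Bin Times (var 0) (var 3))))))"

text \<open>The random vertex is sampled directly into the bottom place of the stack. Order and
  vertex are both drawn afresh, so different trials are independent and identically
  distributed.\<close>

definition trial :: com where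
  "trial =
    Seq (assign 9 (Const 0))
    (Seq shuffle_loop
    (Seq (Sample 13 (Const 1) (var 0))
    (Seq start explore_loop)))"

definition trial_pmf :: "nat \<Rightarrow> nat set set \<Rightarrow> nat \<Rightarrow> nat pmf" where
  "trial_pmf n E b = bind_pmf (pmf_of_set (perms n)) (\<lambda>s.
     map_pmf (\<lambda>v. explore n E s b [(v, 0)]) (pmf_of_set {..<n}))"

definition trial_time :: "nat \<Rightarrow> nat \<Rightarrow> nat" where
  "trial_time n b = (csize explore_body + 222) * (n + b + 1)"

lemma shuffle_start: "shuffle n 0 id = pmf_of_set (perms n)"
  using shuffle_uniform[of 0 n] by (simp add: pmf_of_set_singleton bind_return_pmf)

lemma triple_trial:
  assumes n: "0 < n" and Q: "0 < Q" and m: "m 0 0 = n" "m 3 0 = Q" "mem_le W m"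
    and W: "2 * n + 2 \<le> W" "m 8 0 < W" "Suc n * (12 * (n * Q)) \<le> W"
  shows "triple E m trial (trial_pmf n E (12 * (n * Q)))
    (\<lambda>h m'. m' 8 0 = m 8 0 + h \<and> mem_le W m' \<and> (\<forall>a\<in>{0, 3, 6, 7}. m' a 0 = m a 0))
    (trial_time n (12 * (n * Q)) * bits W)"
proof -
  let ?b = "12 * (n * Q)"
  let ?R = "\<lambda>h m'. m' 8 0 = m 8 0 + h \<and> mem_le W m' \<and> (\<forall>a\<in>{0, 3, 6, 7}. m' a 0 = m a 0)"
  let ?ex = "Suc ?b * (csize explore_body + 22) * bits W"
  have bW: "?b \<le> W" using W(3) by simp
  then have nQ: "n * Q \<le> W" by simp
  have W12: "12 \<le> W" using bW n Q by (cases "n * Q") auto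
  have explore: "triple E m' (Seq start explore_loop) (return_pmf ()) (\<lambda>_. ?R (explore n E s ?b [(v, 0)]))
      (1 + csize start * bits W + ?ex)"
    if s: "s permutes {..<n}" and v: "v < n" and m': "m' 13 1 = v" "\<forall>j<n. m' 11 j = s j"
      "\<forall>a\<in>{0, 3, 6, 7, 8}. m' a 0 = m a 0" "mem_le W m'" for s v m'
  proof (rule triple_Seq_return[OF triple_straight])
    show "cbounded W E start m'"
      using m m' W(1) bW nQ W12 by (simp add: start_def store_apply)
    fix m2
    assume m2: "m2 = exec E start m' \<and> mem_le W m2"
    have w: "wf_stack n E s [(v, 0)]" using v by simp
    have "triple E m2 explore_loop (return_pmf ())
      (\<lambda>_ m3. m3 8 0 = m2 8 0 + explore n E s ?b [(v, 0)] \<and> mem_le W m3 \<and> (\<forall>a\<in>{0, 3, 6, 7}. m3 a 0 = m2 a 0)) ?ex"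
      by (rule triple_explore_loop[OF s w]) (use m2 m' m W in \<open>auto simp: start_def store_apply\<close>)
    then show "triple E m2 explore_loop (return_pmf ()) (\<lambda>_. ?R (explore n E s ?b [(v, 0)])) ?ex"
      by (rule triple_conseq) (use m2 m' in \<open>auto simp: start_def store_apply\<close>)
  qed (use m' in \<open>simp_all add: start_def\<close>)
  have pick: "triple E m' (Seq (Sample 13 (Const 1) (var 0)) (Seq start explore_loop))
      (map_pmf (\<lambda>v. explore n E s ?b [(v, 0)]) (pmf_of_set {..<n})) ?R
      (1 + 8 * bits W + (1 + csize start * bits W + ?ex))"
    if s: "s permutes {..<n}" and m': "\<forall>j<n. m' 11 j = s j"
      "\<forall>a\<in>{0, 3, 6, 7, 8}. m' a 0 = m a 0" "mem_le W m'" for s m'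
  proof (rule triple_map, rule triple_Seq_keep)
    have n': "{..<max 1 (eval_expr m' (var 0))} = {..<n}" using m' m n by simp
    show "triple E m' (Sample 13 (Const 1) (var 0)) (pmf_of_set {..<n})
      (\<lambda>x m2. m2 = store m' 13 1 x \<and> mem_le W m2) (8 * bits W)"
      using triple_Sample_bounded[of W m' "Const 1" "var 0" E 13] m' W(1) unfolding n' by simp
    fix v m2
    assume v: "v \<in> set_pmf (pmf_of_set {..<n})" and m2: "m2 = store m' 13 1 v \<and> mem_le W m2"
    from v n have "v < n" by (simp add: set_pmf_of_set lessThan_empty_iff)
    with s m' m2 show "triple E m2 (Seq start explore_loop) (return_pmf ())
      (\<lambda>_. ?R (explore n E s ?b [(v, 0)])) (1 + csize start * bits W + ?ex)"
      by (intro explore) (auto simp: store_apply)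
  qed
  have rest: "triple E m' (Seq shuffle_loop (Seq (Sample 13 (Const 1) (var 0)) (Seq start explore_loop)))
      (trial_pmf n E ?b) ?R
      (1 + Suc n * 61 * bits W + (1 + 8 * bits W + (1 + csize start * bits W + ?ex)))"
    if m': "m' = store m 9 0 0" "mem_le W m'" for m'
    unfolding trial_pmf_def
  proof (rule triple_Seq)
    have "triple E m' shuffle_loop (shuffle n 0 id)
      (\<lambda>s m2. mem_le W m2 \<and> (\<forall>j<n. m2 11 j = s j) \<and> (\<forall>a\<in>{0, 3, 6, 7, 8}. m2 a 0 = m' a 0))
      (Suc n * 61 * bits W)"
      by (rule triple_shuffle_loop) (use m' m W in \<open>auto simp: store_apply permutes_id\<close>)
    then show "triple E m' shuffle_loop (pmf_of_set (perms n))
      (\<lambda>s m2. mem_le W m2 \<and> (\<forall>j<n. m2 11 j = s j) \<and> (\<forall>a\<in>{0, 3, 6, 7, 8}. m2 a 0 = m' a 0))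
      (Suc n * 61 * bits W)"
      by (simp only: shuffle_start)
    fix s m2
    assume "s \<in> set_pmf (pmf_of_set (perms n))" and m2: "mem_le W m2 \<and> (\<forall>j<n. m2 11 j = s j) \<and>
      (\<forall>a\<in>{0, 3, 6, 7, 8}. m2 a 0 = m' a 0)"
    then have "s permutes {..<n}"
      by (simp add: set_pmf_of_set[OF perms_nonempty finite_perms])
    then show "triple E m2 (Seq (Sample 13 (Const 1) (var 0)) (Seq start explore_loop))
      (map_pmf (\<lambda>v. explore n E s ?b [(v, 0)]) (pmf_of_set {..<n})) ?R
      (1 + 8 * bits W + (1 + csize start * bits W + ?ex))"
      by (rule pick) (use m2 m' in \<open>auto simp: store_apply\<close>)
  qed
  have "triple E m trial (trial_pmf n E ?b) ?R (1 + csize (assign 9 (Const 0)) * bits W +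
      (1 + Suc n * 61 * bits W + (1 + 8 * bits W + (1 + csize start * bits W + ?ex))))"
    unfolding trial_def
  proof (rule triple_Seq_return[OF triple_straight[OF _ m(3)]])
    fix m'
    assume "m' = exec E (assign 9 (Const 0)) m \<and> mem_le W m'"
    then show "triple E m' (Seq shuffle_loop (Seq (Sample 13 (Const 1) (var 0)) (Seq start explore_loop)))
      (trial_pmf n E ?b) ?R
      (1 + Suc n * 61 * bits W + (1 + 8 * bits W + (1 + csize start * bits W + ?ex)))"
      by (intro rest) auto
  qed simp_all
  then show ?thesis
  proof (rule triple_conseq)
    have "1 + csize (assign 9 (Const 0)) * bits W +
      (1 + Suc n * 61 * bits W + (1 + 8 * bits W + (1 + csize start * bits W + ?ex)))
      \<le> (4 + 6 + Suc n * 61 + 8 + csize start + Suc ?b * (csize explore_body + 22)) * bits W"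
      using bits_pos[of W] by (simp add: algebra_simps)
    also have "\<dots> \<le> trial_time n ?b * bits W"
      by (intro mult_right_mono) (simp_all add: trial_time_def start_def algebra_simps)
    finally show "1 + csize (assign 9 (Const 0)) * bits W +
      (1 + Suc n * 61 * bits W + (1 + 8 * bits W + (1 + csize start * bits W + ?ex)))
      \<le> trial_time n ?b * bits W" .
  qed
qed

definition success :: "nat \<Rightarrow> nat set set \<Rightarrow> nat \<Rightarrow> real" where
  "success n E b = real (hits n E b) / (fact n * real n)"

text \<open>A law on 0 and 1 is determined by its mean. So only the mean of a truncated exploration
  has to be known, and this is a counting quantity.\<close>

lemma bernoulli_conv:
  fixes D :: "nat pmf"
  assumes "set_pmf D \<subseteq> {0, 1}"
  shows "D = map_pmf of_bool (bernoulli_pmf (measure_pmf.expectation D real))"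
    and "measure_pmf.expectation D real \<in> {0..1}"
proof -
  have e: "measure_pmf.expectation D real = pmf D 1"
    using assms by (subst integral_measure_pmf_real[of "{0, 1}"]) auto
  show "measure_pmf.expectation D real \<in> {0..1}"
    by (simp add: e pmf_le_1)
  have "(\<Sum>x\<in>{0, 1}. pmf D x) = 1"
    using assms by (intro sum_pmf_eq_1) auto
  then have 0: "pmf D 0 = 1 - pmf D 1" by simp
  show "D = map_pmf of_bool (bernoulli_pmf (measure_pmf.expectation D real))"
  proof (rule pmf_eqI)
    fix x :: nat
    have inj: "inj (of_bool :: bool \<Rightarrow> nat)" by (auto simp: inj_def)
    consider "x = of_bool True" | "x = of_bool False" | "x \<notin> {0, 1}" by auto
    then show "pmf D x = pmf (map_pmf of_bool (bernoulli_pmf (measure_pmf.expectation D real))) x"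
    proof cases
      case 3
      then have "pmf D x = 0" using assms by (auto simp: pmf_eq_0_set_pmf)
      moreover have "pmf (map_pmf of_bool (bernoulli_pmf (measure_pmf.expectation D real))) x = 0"
        using 3 by (subst pmf_eq_0_set_pmf) (auto simp: of_bool_def)
      ultimately show ?thesis by simp
    qed (simp_all only: pmf_map_inj'[OF inj] e, simp_all add: 0 pmf_le_1)
  qed
qed

lemma trial_pmf_bernoulli:
  assumes n: "0 < n"
  shows "trial_pmf n E b = map_pmf of_bool (bernoulli_pmf (success n E b))"
    and "success n E b \<in> {0..1}"
proof -
  have ne: "{..<n} \<noteq> {}" using n by auto
  have D: "trial_pmf n E b =
      map_pmf (\<lambda>(s, v). explore n E s b [(v, 0)]) (pmf_of_set (perms n \<times> {..<n}))"
    unfolding trial_pmf_def map_pmf_def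
    by (simp add: pmf_of_set_bind_Times[OF finite_perms perms_nonempty finite_lessThan ne] case_prod_unfold)
  have fin: "finite (perms n \<times> {..<n})" "perms n \<times> {..<n} \<noteq> {}"
    using perms_nonempty ne finite_perms by auto
  have "explore n E s b [(v, 0)] \<le> 1" if "v < n" for s v
    by (rule order_trans[OF explore_start(1)[OF that]]) simp
  then have ex: "explore n E s b [(v, 0)] \<in> {0, 1}" if "v < n" for s v
    using that by (simp add: le_Suc_eq)
  have "set_pmf (trial_pmf n E b) \<subseteq> {0, 1}"
    unfolding D set_map_pmf set_pmf_of_set[OF fin(2,1)]
  proof (rule image_subsetI)
    fix p
    assume "p \<in> perms n \<times> {..<n}"
    then show "(case p of (s, v) \<Rightarrow> explore n E s b [(v, 0)]) \<in> {0, 1}"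
      using ex[of "snd p" "fst p"] by (simp only: case_prod_unfold mem_Times_iff lessThan_iff)
  qed
  note B = bernoulli_conv[OF this]
  have "measure_pmf.expectation (trial_pmf n E b) real =
      measure_pmf.expectation (pmf_of_set (perms n \<times> {..<n})) (\<lambda>p. real (explore n E (fst p) b [(snd p, 0)]))"
    unfolding D by (simp add: case_prod_unfold)
  also have "\<dots> = (\<Sum>p\<in>perms n \<times> {..<n}. real (explore n E (fst p) b [(snd p, 0)])) / (fact n * real n)"
    using fin by (simp add: integral_pmf_of_set card_cartesian_product card_perms)
  also have "\<dots> = success n E b"
    by (simp add: success_def hits_def sum.cartesian_product case_prod_unfold)
  finally have e: "measure_pmf.expectation (trial_pmf n E b) real = success n E b" .
  show "trial_pmf n E b = map_pmf of_bool (bernoulli_pmf (success n E b))"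
    "success n E b \<in> {0..1}"
    using B unfolding e by auto
qed

section \<open>Independent repetition\<close>

definition main_loop :: com where
  "main_loop = While (var 7) (Seq trial (assign 7 (Bin Minus (var 7) (Const 1))))"

lemma triple_main_loop:
  assumes n: "0 < n" and Q: "0 < Q" and m: "m 0 0 = n" "m 3 0 = Q" "mem_le W m" "m 7 0 = r"
    and W: "2 * n + 2 \<le> W" "m 8 0 + r < W" "Suc n * (12 * (n * Q)) \<le> W"
  shows "triple E m main_loop (binomial_pmf r (success n E (12 * (n * Q))))
    (\<lambda>h m'. m' 8 0 = m 8 0 + h \<and> mem_le W m' \<and> (\<forall>a\<in>{0, 3, 6}. m' a 0 = m a 0))
    (Suc r * (trial_time n (12 * (n * Q)) + 20) * bits W)"
  using m W(2)
proof (induction r arbitrary: m)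
  case 0
  let ?p = "success n E (12 * (n * Q))"
  have z: "eval_expr m (var 7) = 0" using 0 by simp
  have "cost_expr m (var 7) + 1 \<le> 5 * bits W"
    using ebounded_cost[of W m "var 7"] 0 bits_pos[of W] by simp
  then have c: "cost_expr m (var 7) + 1 \<le> Suc 0 * (trial_time n (12 * (n * Q)) + 20) * bits W"
    using bits_pos[of W] by (simp add: algebra_simps)
  have "triple E m main_loop (map_pmf (\<lambda>_. 0) (return_pmf ()))
    (\<lambda>h m'. m' 8 0 = m 8 0 + h \<and> mem_le W m' \<and> (\<forall>a\<in>{0, 3, 6}. m' a 0 = m a 0)) (cost_expr m (var 7) + 1)"
    unfolding main_loop_def
    by (intro triple_map triple_conseq[OF triple_While_false[OF z]]) (use 0 in auto)
  then have "triple E m main_loop (binomial_pmf 0 ?p)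
    (\<lambda>h m'. m' 8 0 = m 8 0 + h \<and> mem_le W m' \<and> (\<forall>a\<in>{0, 3, 6}. m' a 0 = m a 0)) (cost_expr m (var 7) + 1)"
    using trial_pmf_bernoulli(2)[OF n] by (simp add: binomial_pmf_0)
  then show ?case
    by (rule triple_conseq) (use c in auto)
next
  case (Suc r)
  let ?b = "12 * (n * Q)"
  let ?p = "success n E ?b"
  let ?body = "Seq trial (assign 7 (Bin Minus (var 7) (Const 1)))"
  let ?rest = "Suc r * (trial_time n ?b + 20) * bits W"
  have nz: "eval_expr m (var 7) \<noteq> 0" using Suc.prems by simp
  have cost: "cost_expr m (var 7) + 1 \<le> 5 * bits W"
    using ebounded_cost[of W m "var 7"] Suc.prems bits_pos[of W] by simp
  have body: "triple E m ?body (trial_pmf n E ?b)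
    (\<lambda>h m'. m' 7 0 = r \<and> m' 8 0 = m 8 0 + h \<and> mem_le W m' \<and> (\<forall>a\<in>{0, 3, 6}. m' a 0 = m a 0))
    (1 + trial_time n ?b * bits W + 12 * bits W)"
  proof (rule triple_Seq_keep[OF triple_trial[OF n Q Suc.prems(1-3) W(1) _ W(3)]])
    fix h m'
    assume m': "m' 8 0 = m 8 0 + h \<and> mem_le W m' \<and> (\<forall>a\<in>{0, 3, 6, 7}. m' a 0 = m a 0)"
    have "Suc 0 \<le> W" "r \<le> W" using W(1) Suc.prems(5) by simp_all
    then have "triple E m' (assign 7 (Bin Minus (var 7) (Const 1))) (return_pmf ())
      (\<lambda>_ m2. m2 = exec E (assign 7 (Bin Minus (var 7) (Const 1))) m' \<and> mem_le W m2)
      (csize (assign 7 (Bin Minus (var 7) (Const 1))) * bits W)"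
      using m' Suc.prems(4) by (intro triple_straight) auto
    then show "triple E m' (assign 7 (Bin Minus (var 7) (Const 1))) (return_pmf ())
      (\<lambda>_ m2. m2 7 0 = r \<and> m2 8 0 = m 8 0 + h \<and> mem_le W m2 \<and> (\<forall>a\<in>{0, 3, 6}. m2 a 0 = m a 0))
      (12 * bits W)"
      by (rule triple_conseq) (use m' Suc.prems(4) in \<open>auto simp: store_apply\<close>)
  qed (use Suc.prems in simp)
  have "triple E m main_loop (bind_pmf (trial_pmf n E ?b) (\<lambda>h. map_pmf ((+) h) (binomial_pmf r ?p)))
    (\<lambda>h m'. m' 8 0 = m 8 0 + h \<and> mem_le W m' \<and> (\<forall>a\<in>{0, 3, 6}. m' a 0 = m a 0))
    (cost_expr m (var 7) + 1 + (1 + trial_time n ?b * bits W + 12 * bits W) + ?rest)"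
    unfolding main_loop_def
  proof (rule triple_While_true[OF nz body], fold main_loop_def)
    fix h m'
    assume h: "h \<in> set_pmf (trial_pmf n E ?b)"
      and m': "m' 7 0 = r \<and> m' 8 0 = m 8 0 + h \<and> mem_le W m' \<and> (\<forall>a\<in>{0, 3, 6}. m' a 0 = m a 0)"
    \<comment> \<open>Successes so far plus trials left do not increase, so the counter stays below
      \<open>W\<close>.\<close>
    have "h \<le> 1" using h unfolding trial_pmf_bernoulli(1)[OF n] by auto
    then have "triple E m' main_loop (binomial_pmf r ?p)
      (\<lambda>k m2. m2 8 0 = m' 8 0 + k \<and> mem_le W m2 \<and> (\<forall>a\<in>{0, 3, 6}. m2 a 0 = m' a 0)) ?rest"
      using m' Suc.prems by (intro Suc.IH) auto
    then show "triple E m' main_loop (map_pmf ((+) h) (binomial_pmf r ?p))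
      (\<lambda>h m2. m2 8 0 = m 8 0 + h \<and> mem_le W m2 \<and> (\<forall>a\<in>{0, 3, 6}. m2 a 0 = m a 0)) ?rest"
      by - (rule triple_map, erule triple_conseq, use m' in auto)
  qed
  moreover have "bind_pmf (trial_pmf n E ?b) (\<lambda>h. map_pmf ((+) h) (binomial_pmf r ?p)) = binomial_pmf (Suc r) ?p"
    unfolding trial_pmf_bernoulli(1)[OF n]
    by (simp only: binomial_pmf_Suc[OF trial_pmf_bernoulli(2)[OF n]] bind_map_pmf of_bool_def)
      (simp add: map_pmf_def)
  ultimately have "triple E m main_loop (binomial_pmf (Suc r) ?p)
    (\<lambda>h m'. m' 8 0 = m 8 0 + h \<and> mem_le W m' \<and> (\<forall>a\<in>{0, 3, 6}. m' a 0 = m a 0))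
    (cost_expr m (var 7) + 1 + (1 + trial_time n ?b * bits W + 12 * bits W) + ?rest)"
    by simp
  then show ?case
    by (rule triple_conseq) (use cost bits_pos[of W] in \<open>auto simp: algebra_simps\<close>)
qed

section \<open>Logarithm, parameters and rounding of the output\<close>

definition log_loop :: com where
  "log_loop = While (var 4)
    (Seq (assign 4 (Bin Divide (var 4) (Const 2))) (assign 5 (Bin Plus (var 5) (Const 1))))"

lemma bits_rec: "2 \<le> x \<Longrightarrow> bits x = Suc (bits (x div 2))"
  unfolding bits_def using floor_log_rec by metis

lemma bits_le: "0 < x \<Longrightarrow> bits x \<le> x"
proof (induction x rule: less_induct)
  case (less x)
  then show ?case
    using bits_rec[of x] less.IH[of "x div 2"] by (cases "x = 1") (auto simp: bits_def)
qed

text \<open>The number of passes of the halving loop. It differs from \<open>bits\<close> only at 0,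
  where \<open>bits\<close> is 1 but the loop makes no pass.\<close>

definition bit_length :: "nat \<Rightarrow> nat" where
  "bit_length x = (if x = 0 then 0 else bits x)"

lemma bit_length_rec: "x \<noteq> 0 \<Longrightarrow> bit_length x = Suc (bit_length (x div 2))"
  using bits_rec[of x] by (cases "x = 1") (auto simp: bit_length_def bits_def)

lemma triple_log_loop:
  assumes "mem_le W m" "m 5 0 + bit_length (m 4 0) \<le> W" "2 \<le> W"
  shows "triple E m log_loop (return_pmf ())
    (\<lambda>_ m'. m' 5 0 = m 5 0 + bit_length (m 4 0) \<and> mem_le W m' \<and> (\<forall>a\<in>{0, 3, 8}. m' a 0 = m a 0))
    (Suc (bit_length (m 4 0)) * 40 * bits W)"
  using assms
proof (induction "m 4 0" arbitrary: m rule: less_induct)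
  case less
  let ?body = "Seq (assign 4 (Bin Divide (var 4) (Const 2))) (assign 5 (Bin Plus (var 5) (Const 1)))"
  have cost: "cost_expr m (var 4) + 1 \<le> 5 * bits W"
    using ebounded_cost[of W m "var 4"] less.prems bits_pos[of W] by simp
  show ?case
  proof (cases "m 4 0 = 0")
    case True
    then have z: "eval_expr m (var 4) = 0" by simp
    show ?thesis
      unfolding log_loop_def
    proof (rule triple_conseq[OF triple_While_false[OF z]])
      show "cost_expr m (var 4) + 1 \<le> Suc (bit_length (m 4 0)) * 40 * bits W"
        using cost by (simp add: bit_length_def True)
    qed (use True less.prems in \<open>auto simp: bit_length_def\<close>)
  next
    case False
    then have nz: "eval_expr m (var 4) \<noteq> 0" by simp
    define m1 where "m1 = exec E ?body m"
    have m1: "m1 4 0 = m 4 0 div 2" "m1 5 0 = Suc (m 5 0)" "\<forall>a\<in>{0, 3, 8}. m1 a 0 = m a 0"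
      by (simp_all add: m1_def store_apply)
    have bl: "bit_length (m 4 0) = Suc (bit_length (m1 4 0))"
      using bit_length_rec[OF False] m1(1) by simp
    have mW: "m a i \<le> W" for a i using less.prems by (simp add: mem_le_def)
    have "m 4 0 div 2 \<le> W"
      using mW[of 4 0] by (meson div_le_dividend order_trans)
    moreover have "Suc (m 5 0) \<le> W"
      using less.prems(2) bl by simp
    ultimately have body: "triple E m ?body (return_pmf ()) (\<lambda>_ m'. m' = m1 \<and> mem_le W m') (csize ?body * bits W)"
      unfolding m1_def using less.prems by (intro triple_straight) (auto simp: store_apply)
    have "triple E m log_loop (return_pmf ())
      (\<lambda>_ m'. m' 5 0 = m 5 0 + bit_length (m 4 0) \<and> mem_le W m' \<and> (\<forall>a\<in>{0, 3, 8}. m' a 0 = m a 0))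
      (cost_expr m (var 4) + 1 + csize ?body * bits W + Suc (bit_length (m1 4 0)) * 40 * bits W)"
      unfolding log_loop_def
    proof (rule triple_While_true_return[OF nz body], fold log_loop_def)
      fix m2
      assume m2: "m2 = m1 \<and> mem_le W m2"
      have "m1 4 0 < m 4 0" using False m1(1) by simp
      then have "triple E m1 log_loop (return_pmf ())
        (\<lambda>_ m'. m' 5 0 = m1 5 0 + bit_length (m1 4 0) \<and> mem_le W m' \<and> (\<forall>a\<in>{0, 3, 8}. m' a 0 = m1 a 0))
        (Suc (bit_length (m1 4 0)) * 40 * bits W)"
        using m2 m1(2) bl less.prems by (intro less.hyps) auto
      then show "triple E m2 log_loop (return_pmf ())
        (\<lambda>_ m'. m' 5 0 = m 5 0 + bit_length (m 4 0) \<and> mem_le W m' \<and> (\<forall>a\<in>{0, 3, 8}. m' a 0 = m a 0))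
        (Suc (bit_length (m1 4 0)) * 40 * bits W)"
        unfolding conjunct1[OF m2] by (rule triple_conseq) (use m1(2,3) bl in auto)
    qed
    then show ?thesis
      by (rule triple_conseq) (use cost in \<open>auto simp: bl algebra_simps\<close>)
  qed
qed

text \<open>The program is fixed before \<open>n\<close>, so \<open>q\<close> may exceed
  \<open>n\<close> by far. Accuracy \<open>1 / n\<close> is always enough because the optima are
  integers, and the cap keeps the later computed numbers polynomial in \<open>n\<close> however
  small \<epsilon> is.\<close>

definition setup_accuracy :: "nat \<Rightarrow> com" where
  "setup_accuracy q = If (Bin Less (var 0) (Const q)) (assign 3 (var 0)) (assign 3 (Const q))"

definition setup_trials :: "nat \<Rightarrow> com" where
  "setup_trials c = Seq (assign 6 (Bin Times (Const c) (Bin Times (Bin Times (var 3) (var 3)) (var 5))))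
    (assign 7 (var 6))"

definition finish :: com where
  "finish =
    Seq (assign 2 (Bin Divide
      (Bin Times (var 0) (Bin Plus (Bin Times (Const 2) (Bin Times (var 3) (var 8))) (var 6)))
      (Bin Times (Const 2) (Bin Times (var 3) (var 6)))))
    (assign 1 (Bin Divide
      (Bin Plus
        (Bin Times (var 0) (Bin Minus (Bin Times (Const 4) (Bin Times (var 3) (var 8))) (var 6)))
        (Bin Minus (Bin Times (Const 8) (Bin Times (var 3) (var 6))) (Const 1)))
      (Bin Times (Const 8) (Bin Times (var 3) (var 6)))))"

definition program :: "nat \<Rightarrow> nat \<Rightarrow> com" where
  "program c q = Seq (setup_accuracy q) (Seq (assign 4 (var 0)) (Seq log_loop
    (Seq (setup_trials c) (Seq main_loop finish))))"

text \<open>This is \<open>n * (x / R - 1 / (4 * Q)) / 2\<close>, rounded up, with negative values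
  replaced by 0. The offset covers the sampling error only, since truncation can only lower the
  success rate.\<close>

definition matching_estimate :: "nat \<Rightarrow> nat \<Rightarrow> nat \<Rightarrow> nat \<Rightarrow> nat" where
  "matching_estimate n Q R x = (n * (4 * (Q * x) - R) + (8 * (Q * R) - 1)) div (8 * (Q * R))"

text \<open>This is \<open>n * (x / R + 1 / (2 * Q))\<close>, rounded down. One half of the offset
  covers the sampling error, the other half the loss by truncation.\<close>

definition cover_estimate :: "nat \<Rightarrow> nat \<Rightarrow> nat \<Rightarrow> nat \<Rightarrow> nat" where
  "cover_estimate n Q R x = n * (2 * (Q * x) + R) div (2 * (Q * R))"

text \<open>The constant \<open>q\<close> need not be bounded by \<open>W\<close>, so the comparison
  is charged by hand, with \<open>2 * q\<close> for its bit lengths. The assignment of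
  \<open>q\<close> is executed only if \<open>q \<le> n\<close>, where the general rule applies
  again.\<close>

lemma triple_setup_accuracy:
  assumes "mem_le W m" "m 0 0 = n" "1 \<le> W"
  shows "triple E m (setup_accuracy q) (return_pmf ()) (\<lambda>_ m'. m' = store m 3 0 (min n q) \<and> mem_le W m')
    (20 * bits W + 2 * q)"
proof -
  have n: "n \<le> W" using assms by (auto simp: mem_le_def)
  have q: "bits q \<le> q + 1" using bits_le[of q] by (cases "q = 0") (auto simp: bits_def)
  have "cost_expr m (Bin Less (var 0) (Const q)) \<le> 4 * bits W + 2 * q + 2"
    using assms(2) bits_mono[OF n] bits_pos[of W] q by (simp add: bits_def)
  then have cost: "cost_expr m (Bin Less (var 0) (Const q)) + 1 + 10 * bits W \<le> 20 * bits W + 2 * q"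
    using bits_pos[of W] by linarith
  have "triple E m (if eval_expr m (Bin Less (var 0) (Const q)) \<noteq> 0 then assign 3 (var 0) else assign 3 (Const q))
    (return_pmf ()) (\<lambda>_ m'. m' = store m 3 0 (min n q) \<and> mem_le W m') (10 * bits W)"
  proof (cases "n < q")
    case True
    have "triple E m (assign 3 (var 0)) (return_pmf ())
      (\<lambda>_ m'. m' = exec E (assign 3 (var 0)) m \<and> mem_le W m') (csize (assign 3 (var 0)) * bits W)"
      using assms by (intro triple_straight) auto
    then show ?thesis
      using True assms(2) by (auto elim!: triple_conseq)
  next
    case False
    have "triple E m (assign 3 (Const q)) (return_pmf ())
      (\<lambda>_ m'. m' = exec E (assign 3 (Const q)) m \<and> mem_le W m') (csize (assign 3 (Const q)) * bits W)"
      using assms n False by (intro triple_straight) auto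
    then show ?thesis
      using False assms(2) by (auto elim!: triple_conseq)
  qed
  then have "triple E m (setup_accuracy q) (return_pmf ()) (\<lambda>_ m'. m' = store m 3 0 (min n q) \<and> mem_le W m')
    (cost_expr m (Bin Less (var 0) (Const q)) + 1 + 10 * bits W)"
    unfolding setup_accuracy_def by (rule triple_If)
  then show ?thesis
    by (rule triple_conseq) (use cost in auto)
qed

definition num_trials :: "nat \<Rightarrow> nat \<Rightarrow> nat \<Rightarrow> nat" where
  "num_trials c n Q = c * (Q * Q * bits n)"

text \<open>The argument \<open>24 * (n * n * (Q * R))\<close> bounds all numbers of the computation
  except possibly the constant \<open>q\<close>, which the last summand pays for.\<close>

definition total_time :: "nat \<Rightarrow> nat \<Rightarrow> nat \<Rightarrow> nat \<Rightarrow> nat" where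
  "total_time q n Q R = (500 + 40 * bits n + Suc R * (trial_time n (12 * (n * Q)) + 20)) *
     bits (24 * (n * n * (Q * R))) + 2 * q"

lemma program_reaches:
  fixes E :: "nat set set"
  assumes n: "0 < n" and q: "0 < q" and c: "0 < c"
  defines "Q \<equiv> min n q"
  defines "R \<equiv> num_trials c n Q"
  shows "reaches E (initial (program c q) n) (total_time q n Q R)
    (map_pmf (\<lambda>x. (matching_estimate n Q R x, cover_estimate n Q R x))
      (binomial_pmf R (success n E (12 * (n * Q)))))"
proof -
  define W where "W = 24 * (n * n * (Q * R))"
  let ?p = "success n E (12 * (n * Q))"
  have Q: "0 < Q" "Q \<le> n" using n q by (auto simp: Q_def)
  have l: "1 \<le> bits n" "bits n \<le> n" using bits_pos bits_le n by auto
  have R: "0 < R" "bits n \<le> R" "Q * Q * bits n \<le> R" "Q * Q \<le> R" "c \<le> R" "Q \<le> R"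
  proof -
    have "0 < Q * Q * bits n" using Q l by simp
    then show "0 < R" "bits n \<le> R" "Q * Q * bits n \<le> R" "Q * Q \<le> R" "c \<le> R" "Q \<le> R"
      using Q l c by (auto simp: R_def num_trials_def Suc_le_eq)
  qed
  have nQR: "n * (Q * R) \<le> n * n * (Q * R)" "n * n \<le> n * n * (Q * R)" "Q * R \<le> n * (Q * R)"
    "n \<le> n * n" "R \<le> Q * R" "n * n * Q \<le> n * n * (Q * R)"
    using n Q R(1) by auto
  have W: "2 * n + 2 \<le> W" "R < W" "Suc n * (12 * (n * Q)) \<le> W" "1 \<le> W" "8 * (Q * R) \<le> W" "12 * (n * (Q * R)) \<le> W"
    "24 \<le> W"
  proof -
    have "1 \<le> n * n * (Q * R)" using n Q R(1) by (simp add: Suc_le_eq)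
    then show "1 \<le> W" "24 \<le> W" by (simp_all add: W_def)
    show "2 * n + 2 \<le> W" "R < W" "8 * (Q * R) \<le> W" "12 * (n * (Q * R)) \<le> W"
      using nQR n R(1) unfolding W_def by linarith+
    have "Suc n * (12 * (n * Q)) = 12 * (n * n * Q) + 12 * (n * Q)" by (simp add: algebra_simps)
    also have "n * Q \<le> n * n * Q" using n by simp
    finally show "Suc n * (12 * (n * Q)) \<le> W" using nQR(6) unfolding W_def by linarith
  qed
  define m0 where "m0 = store (\<lambda>_ _. 0) 0 0 n"
  have m0: "m0 0 0 = n" "mem_le W m0" "m0 5 0 = 0" "m0 8 0 = 0"
    using W by (auto simp: m0_def store_apply mem_le_def)
  have fin: "triple E m finish (return_pmf ())
      (\<lambda>_ m'. m' 1 0 = matching_estimate n Q R x \<and> m' 2 0 = cover_estimate n Q R x) (csize finish * bits W)"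
    if m: "m 0 0 = n" "m 3 0 = Q" "m 6 0 = R" "m 8 0 = x" "mem_le W m" and x: "x \<le> R" for m x
  proof (rule triple_conseq[OF triple_straight])
    have Qx: "Q * x \<le> Q * R" using x by simp
    have "2 * (Q * x) + R \<le> 3 * (Q * R)" using Qx nQR(5) by linarith
    then have "n * (2 * (Q * x) + R) \<le> n * (3 * (Q * R))" by (rule mult_left_mono) simp
    also have "\<dots> = 3 * (n * (Q * R))" by simp
    finally have 1: "n * (2 * (Q * x) + R) \<le> W" using W(6) by linarith
    have "4 * (Q * x) - R \<le> 4 * (Q * R)" using Qx by linarith
    then have "n * (4 * (Q * x) - R) \<le> n * (4 * (Q * R))" by (rule mult_left_mono) simp
    also have "\<dots> = 4 * (n * (Q * R))" by simp
    finally have 2: "n * (4 * (Q * x) - R) + (8 * (Q * R) - 1) \<le> W"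
      "n * (4 * (Q * x) - R) \<le> W"
      using W(6) nQR(3) by linarith+
    have 3: "Q * x \<le> W" "Q * R \<le> W" "2 * (Q * x) + R \<le> W" "2 * (Q * x) \<le> W" "4 * (Q * x) \<le> W"
      "4 * (Q * x) - R \<le> W" "8 * (Q * R) - 1 \<le> W" "2 * (Q * R) \<le> W"
      using Qx W(5) nQR(5) by linarith+
    have 4: "n * (2 * (Q * x) + R) div (2 * (Q * R)) \<le> W"
      "(n * (4 * (Q * x) - R) + (8 * (Q * R) - 1)) div (8 * (Q * R)) \<le> W"
      using 1 2 by (meson div_le_dividend order_trans)+
    show "cbounded W E finish m"
      using 1 2 3 4 W m by (simp add: finish_def store_apply)
  qed (use m in \<open>auto simp: finish_def store_apply matching_estimate_def cover_estimate_def\<close>)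
  let ?T1 = "1 + csize (setup_trials c) * bits W +
      (1 + Suc R * (trial_time n (12 * (n * Q)) + 20) * bits W + csize finish * bits W)"
  have main: "triple E m (Seq (setup_trials c) (Seq main_loop finish)) (binomial_pmf R ?p)
      (\<lambda>x m'. m' 1 0 = matching_estimate n Q R x \<and> m' 2 0 = cover_estimate n Q R x) ?T1"
    if m: "m 0 0 = n" "m 3 0 = Q" "m 5 0 = bits n" "m 8 0 = 0" "mem_le W m" for m
  proof (rule triple_Seq_return[OF triple_straight])
    have "c * (Q * Q * bits n) = R" by (simp add: R_def num_trials_def)
    then have "c * (Q * Q * bits n) \<le> W" "Q * Q * bits n \<le> W" "Q * Q \<le> W" "c \<le> W"
      using R W(2) by linarith+
    then show "cbounded W E (setup_trials c) m"
      using m W by (simp add: setup_trials_def store_apply)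
    fix m'
    assume m': "m' = exec E (setup_trials c) m \<and> mem_le W m'"
    then have m'_eqs: "m' 0 0 = n" "m' 3 0 = Q" "m' 6 0 = R" "m' 7 0 = R" "m' 8 0 = 0"
      using m by (auto simp: setup_trials_def store_apply R_def num_trials_def)
    show "triple E m' (Seq main_loop finish) (binomial_pmf R ?p)
      (\<lambda>x m'. m' 1 0 = matching_estimate n Q R x \<and> m' 2 0 = cover_estimate n Q R x)
      (1 + Suc R * (trial_time n (12 * (n * Q)) + 20) * bits W + csize finish * bits W)"
    proof (rule triple_Seq_keep[OF triple_main_loop[OF n Q(1) m'_eqs(1,2) conjunct2[OF m'] m'_eqs(4) W(1)]])
      fix x m2
      assume x: "x \<in> set_pmf (binomial_pmf R ?p)"
        and m2: "m2 8 0 = m' 8 0 + x \<and> mem_le W m2 \<and> (\<forall>a\<in>{0, 3, 6}. m2 a 0 = m' a 0)"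
      have "x \<le> R"
        using x trial_pmf_bernoulli(2)[OF n] by (auto simp: set_pmf_binomial_eq split: if_splits)
      then show "triple E m2 finish (return_pmf ())
        (\<lambda>_ m'. m' 1 0 = matching_estimate n Q R x \<and> m' 2 0 = cover_estimate n Q R x) (csize finish * bits W)"
        using m2 m'_eqs by (intro fin) auto
    qed (use W m'_eqs in auto)
  qed (use m in \<open>simp_all add: setup_trials_def\<close>)
  let ?T2 = "1 + 8 * bits W + (1 + Suc (bits n) * 40 * bits W + ?T1)"
  have "triple E m0 (program c q) (binomial_pmf R ?p)
      (\<lambda>x m'. m' 1 0 = matching_estimate n Q R x \<and> m' 2 0 = cover_estimate n Q R x)
      (1 + (20 * bits W + 2 * q) + ?T2)"
    unfolding program_def
  proof (rule triple_Seq_return[OF triple_setup_accuracy[OF m0(2,1) W(4)]])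
    fix m1
    assume m1: "m1 = store m0 3 0 (min n q) \<and> mem_le W m1"
    show "triple E m1 (Seq (assign 4 (var 0)) (Seq log_loop (Seq (setup_trials c) (Seq main_loop finish))))
        (binomial_pmf R ?p)
        (\<lambda>x m'. m' 1 0 = matching_estimate n Q R x \<and> m' 2 0 = cover_estimate n Q R x) ?T2"
    proof (rule triple_Seq_return)
      have "triple E m1 (assign 4 (var 0)) (return_pmf ())
        (\<lambda>_ m'. m' = exec E (assign 4 (var 0)) m1 \<and> mem_le W m') (csize (assign 4 (var 0)) * bits W)"
        using m1 W by (intro triple_straight) auto
      then show "triple E m1 (assign 4 (var 0)) (return_pmf ())
        (\<lambda>_ m'. m' = exec E (assign 4 (var 0)) m1 \<and> mem_le W m') (8 * bits W)"
        by simp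
      fix m2
      assume m2: "m2 = exec E (assign 4 (var 0)) m1 \<and> mem_le W m2"
      then have m2_eqs: "m2 0 0 = n" "m2 3 0 = Q" "m2 4 0 = n" "m2 5 0 = 0" "m2 8 0 = 0"
        using m1 m0 by (auto simp: store_apply Q_def)
      show "triple E m2 (Seq log_loop (Seq (setup_trials c) (Seq main_loop finish))) (binomial_pmf R ?p)
        (\<lambda>x m'. m' 1 0 = matching_estimate n Q R x \<and> m' 2 0 = cover_estimate n Q R x)
        (1 + Suc (bits n) * 40 * bits W + ?T1)"
      proof (rule triple_Seq_return)
        have "bit_length n = bits n" using n by (simp add: bit_length_def)
        then show "triple E m2 log_loop (return_pmf ())
          (\<lambda>_ m'. m' 5 0 = bits n \<and> mem_le W m' \<and> (\<forall>a\<in>{0, 3, 8}. m' a 0 = m2 a 0))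
          (Suc (bits n) * 40 * bits W)"
          using triple_log_loop[OF conjunct2[OF m2], of E] m2_eqs l W by simp
        fix m3
        assume "m3 5 0 = bits n \<and> mem_le W m3 \<and> (\<forall>a\<in>{0, 3, 8}. m3 a 0 = m2 a 0)"
        then show "triple E m3 (Seq (setup_trials c) (Seq main_loop finish)) (binomial_pmf R ?p)
          (\<lambda>x m'. m' 1 0 = matching_estimate n Q R x \<and> m' 2 0 = cover_estimate n Q R x) ?T1"
          using m2_eqs by (intro main) simp_all
      qed
    qed
  qed
  then have "triple E m0 (program c q) (binomial_pmf R ?p)
      (\<lambda>x m'. m' 1 0 = matching_estimate n Q R x \<and> m' 2 0 = cover_estimate n Q R x)
      (total_time q n Q R)"
  proof (rule triple_conseq)
    have c: "csize (setup_trials c) \<le> 100" "csize finish \<le> 200"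
      by (simp_all add: setup_trials_def finish_def)
    define s where "s = csize (setup_trials c) * bits W"
    define f where "f = csize finish * bits W"
    have "s \<le> 100 * bits W" "f \<le> 200 * bits W"
      using c by (auto simp: s_def f_def)
    then show "1 + (20 * bits W + 2 * q) + ?T2 \<le> total_time q n Q R"
      unfolding total_time_def W_def[symmetric] s_def[symmetric] f_def[symmetric] using bits_pos[of W]
      by (simp add: algebra_simps)
  qed
  then have "reaches E (Config [program c q] m0 0 0) (total_time q n Q R)
    (map_pmf (\<lambda>x. (matching_estimate n Q R x, cover_estimate n Q R x)) (binomial_pmf R ?p))"
    by (rule triple_reaches) auto
  then show ?thesis
    by (simp add: initial_def m0_def)
qed

section \<open>Accuracy and running time\<close>

text \<open>In either direction the offsets and errors add up to \<open>3 * n / (4 * Q)\<close>. For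
  \<open>Q \<noteq> n\<close> this is at most \<open>\<epsilon> * n\<close>. For
  \<open>Q = n\<close> it is less than 1, and integrality removes it altogether. The factor
  \<open>T\<close> clears the denominators.\<close>

lemma estimates_correct:
  fixes \<mu> \<nu> x n Q R :: nat and p M \<epsilon> :: real
  assumes pos: "0 < n" "0 < Q" "0 < R" "0 < \<epsilon>"
    and M: "\<mu> \<le> M" "M \<le> 2 * \<mu>" "\<nu> \<le> M" "M \<le> 2 * \<nu>"
    and p: "n * p \<le> M" "M \<le> n * p + n / (4 * Q)"
    and x: "\<bar>x / R - p\<bar> < 1 / (4 * Q)"
    and Q: "Q = n \<or> 1 \<le> \<epsilon> * Q"
  shows "real \<mu> / 2 - \<epsilon> * n \<le> matching_estimate n Q R x" "matching_estimate n Q R x \<le> real \<mu>"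
    "\<nu> \<le> real (cover_estimate n Q R x)" "cover_estimate n Q R x \<le> 2 * real \<nu> + \<epsilon> * n"
proof -
  define T where "T = 4 * real Q * real R"
  have T: "0 < T" using pos by (simp add: T_def)
  have "\<bar>T * (x / R - p)\<bar> = T * \<bar>x / R - p\<bar>" using T by (simp add: abs_mult)
  also have "\<dots> < T * (1 / (4 * Q))" using x T by (rule mult_strict_left_mono)
  also have "T * (1 / (4 * Q)) = R" using pos by (simp add: T_def)
  also have "T * (x / R - p) = 4 * Q * x - T * p"
    using pos by (simp add: T_def field_simps)
  finally have h: "4 * real Q * x < T * p + R" "T * p < 4 * real Q * x + R"
    by (auto simp: abs_less_iff)
  have nh: "n * (4 * real Q * x) \<le> n * (T * p + R)" "n * (T * p) \<le> n * (4 * real Q * x + R)"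
    using h by (auto intro!: mult_left_mono)
  have TM: "T * (n * p) \<le> T * M" "T * M \<le> T * (n * p) + n * R"
  proof -
    show "T * (n * p) \<le> T * M" using p T by simp
    have "T * M \<le> T * (n * p + n / (4 * Q))" using p T by simp
    also have "\<dots> = T * (n * p) + n * R" using pos by (simp add: T_def field_simps)
    finally show "T * M \<le> T * (n * p) + n * R" .
  qed
  have Mb: "T * \<mu> \<le> T * M" "T * M \<le> T * (2 * \<mu>)" "T * \<nu> \<le> T * M" "T * M \<le> T * (2 * \<nu>)"
    using M T by simp_all
  have err: "3 * n * R = T * (3 * n / (4 * Q))" using pos by (simp add: T_def)
  have err_le: "Q \<noteq> n \<Longrightarrow> 3 * real n / (4 * Q) \<le> \<epsilon> * n"
  proof -
    assume "Q \<noteq> n"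
    then have "real n * 1 \<le> real n * (\<epsilon> * Q)" using Q by (intro mult_left_mono) auto
    then have "3 * real n \<le> 4 * (n * (\<epsilon> * Q))" by simp
    then show ?thesis using pos by (simp add: field_simps)
  qed
  have err_eq: "Q = n \<Longrightarrow> 3 * real n / (4 * Q) = 3 / 4" using pos by simp

  show "\<nu> \<le> real (cover_estimate n Q R x)"
  proof -
    have "T * \<nu> \<le> 2 * (n * (2 * real Q * x + R))"
      using Mb(3) TM(2) nh(2) by (simp add: algebra_simps)
    then have "real (\<nu> * (2 * (Q * R))) \<le> real (n * (2 * (Q * x) + R))"
      by (simp add: T_def algebra_simps)
    then have "\<nu> * (2 * (Q * R)) \<le> n * (2 * (Q * x) + R)" by (simp only: of_nat_le_iff)
    then have "\<nu> \<le> cover_estimate n Q R x"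
      unfolding cover_estimate_def using pos by (subst less_eq_div_iff_mult_less_eq) auto
    then show ?thesis by simp
  qed
  show "cover_estimate n Q R x \<le> 2 * real \<nu> + \<epsilon> * n"
  proof -
    let ?c = "cover_estimate n Q R x"
    have "?c * (2 * (Q * R)) \<le> n * (2 * (Q * x) + R)"
      unfolding cover_estimate_def by (rule div_times_less_eq_dividend)
    then have "real (?c * (2 * (Q * R))) \<le> real (n * (2 * (Q * x) + R))" by (simp only: of_nat_le_iff)
    then have "T * ?c \<le> 2 * (n * (2 * real Q * x + R))"
      by (simp add: T_def algebra_simps)
    also have "\<dots> \<le> T * (2 * \<nu>) + 3 * n * R"
      using nh(1) TM(1) Mb(4) by (simp add: algebra_simps)
    also have "\<dots> = T * (2 * \<nu> + 3 * n / (4 * Q))" unfolding err by (simp add: algebra_simps)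
    finally have c: "?c \<le> 2 * \<nu> + 3 * n / (4 * Q)" using T by simp
    show ?thesis
    proof (cases "Q = n")
      case True
      then have "real ?c < real (2 * \<nu> + 1)" using c err_eq by simp
      then have "?c \<le> 2 * \<nu>" by linarith
      then have "real ?c \<le> 2 * real \<nu>" by linarith
      moreover have "0 \<le> \<epsilon> * n" using pos by simp
      ultimately show ?thesis by linarith
    qed (use c err_le in linarith)
  qed
  let ?D = "8 * (Q * R)" and ?z = "n * (4 * (Q * x) - R)"
  have z: "n * (4 * real Q * x - R) \<le> real ?z"
  proof -
    have "real (4 * (Q * x)) - R \<le> real (4 * (Q * x) - R)" by linarith
    then have "4 * real Q * x - R \<le> real (4 * (Q * x) - R)" by simp
    then show ?thesis unfolding of_nat_mult[of n] by (rule mult_left_mono) simp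
  qed
  show "matching_estimate n Q R x \<le> real \<mu>"
  proof -
    have "?z \<le> \<mu> * ?D"
    proof (cases "4 * (Q * x) \<le> R")
      case False
      then have "real ?z = n * (4 * real Q * x - R)" by (simp add: of_nat_diff)
      also have "\<dots> \<le> 2 * (T * \<mu>)"
        using nh(1) TM(1) Mb(2) by (simp add: algebra_simps)
      finally have "real ?z \<le> real (\<mu> * ?D)" by (simp add: T_def algebra_simps)
      then show ?thesis by (simp only: of_nat_le_iff)
    qed simp
    moreover have "0 < ?D" "Suc \<mu> * ?D = \<mu> * ?D + ?D" using pos by simp_all
    ultimately have "?z + (?D - 1) < Suc \<mu> * ?D" by linarith
    then have "matching_estimate n Q R x < Suc \<mu>"
      unfolding matching_estimate_def using pos by (subst div_less_iff_less_mult) auto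
    then show ?thesis by simp
  qed
  show "real \<mu> / 2 - \<epsilon> * n \<le> matching_estimate n Q R x"
  proof -
    let ?e = "matching_estimate n Q R x"
    have "?z + (?D - 1) < Suc ?e * ?D"
      unfolding matching_estimate_def using pos by (subst div_less_iff_less_mult[symmetric]) auto
    then have "?z \<le> ?e * ?D" using pos by simp
    then have "real ?z \<le> real (?e * ?D)" by (simp only: of_nat_le_iff)
    then have "n * (4 * real Q * x - R) \<le> T * (2 * ?e)"
      using z by (simp add: T_def algebra_simps)
    then have "T * \<mu> \<le> T * (2 * ?e) + 3 * n * R"
      using nh(2) TM(2) Mb(1) by (simp add: algebra_simps)
    also have "\<dots> = T * (2 * ?e + 3 * n / (4 * Q))" unfolding err by (simp add: algebra_simps)
    finally have e: "\<mu> \<le> 2 * ?e + 3 * n / (4 * Q)" using T by simp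
    show ?thesis
    proof (cases "Q = n")
      case True
      then have "real \<mu> < real (2 * ?e + 1)" using e err_eq by simp
      then have "\<mu> \<le> 2 * ?e" by linarith
      then have "real \<mu> \<le> 2 * real ?e" by linarith
      moreover have "0 \<le> \<epsilon> * n" using pos by simp
      ultimately show ?thesis by linarith
    next
      case False
      moreover have "0 \<le> \<epsilon> * n" using pos by simp
      ultimately show ?thesis using e err_le by linarith
    qed
  qed
qed

lemma less_exp_bits: "real n \<le> exp (bits n)" "2 \<le> exp (real (bits n))"
proof -
  have two: "(2 :: real) \<le> exp 1" using exp_ge_add_one_self[of 1] by simp
  have *: "2 ^ bits n \<le> exp (real (bits n))"
    using power_mono[OF two, of "bits n"] by (simp add: exp_of_nat_mult[symmetric])
  have "n < 2 ^ bits n" using floor_log_exp2_gt[of n] by (simp add: bits_def)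
  then have "real n \<le> 2 ^ bits n" by (metis less_imp_le of_nat_le_numeral_power_cancel_iff)
  then show "real n \<le> exp (bits n)" using * by linarith
  have "(2 :: real) ^ 1 \<le> 2 ^ bits n" using bits_pos[of n] by (intro power_increasing) auto
  then show "2 \<le> exp (real (bits n))" using * by simp
qed

text \<open>Hoeffding's inequality with deviation \<open>1 / (4 * Q)\<close> has exponent
  \<open>2 * R / (16 * Q * Q)\<close>, and the factor \<open>8 * Suc k\<close> turns it into
  \<open>Suc k * bits n\<close>. One factor \<open>exp (- bits n)\<close> absorbs the leading 2, and
  the other \<open>k\<close> give the power of \<open>n\<close>.\<close>

lemma sampling_error:
  fixes n Q k :: nat and p :: real
  assumes n: "0 < n" and Q: "0 < Q" and p: "p \<in> {0..1}"
  defines "R \<equiv> num_trials (8 * Suc k) n Q"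
  shows "measure_pmf.prob (binomial_pmf R p) {x. \<bar>x / R - p\<bar> \<ge> 1 / (4 * Q)} \<le> 1 / real n ^ k"
proof -
  have R: "0 < R" using n Q bits_pos[of n] by (simp add: R_def num_trials_def)
  interpret binomial_distribution R p by unfold_locales (use p in auto)
  have "measure_pmf.prob (binomial_pmf R p) {x. \<bar>x / R - p\<bar> \<ge> 1 / (4 * Q)}
      \<le> 2 * exp (-2 * real R * (1 / (4 * real Q))\<^sup>2)"
    using prob_abs_ge'[OF R, of "1 / (4 * real Q)"] by simp
  also have "-2 * real R * (1 / (4 * real Q))\<^sup>2 = - (real (Suc k) * bits n)"
    using Q by (simp add: R_def num_trials_def power2_eq_square field_simps)
  also have "exp (- (real (Suc k) * bits n)) = exp (- real (bits n)) * exp (- (real k * bits n))"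
    by (simp add: exp_add[symmetric] algebra_simps)
  also have "2 * (exp (- real (bits n)) * exp (- (real k * bits n))) \<le> 1 * exp (- (real k * bits n))"
    unfolding mult.assoc[symmetric]
    using less_exp_bits(2)[of n] by (intro mult_right_mono) (auto simp: exp_minus field_simps)
  also have "\<dots> = 1 / exp (bits n) ^ k"
    by (simp add: exp_of_nat_mult[symmetric] exp_minus field_simps)
  also have "\<dots> \<le> 1 / real n ^ k"
    using n less_exp_bits(1)[of n] by (intro divide_left_mono power_mono mult_pos_pos zero_less_power) auto
  finally show ?thesis .
qed

lemma bits_le_log: "0 < x \<Longrightarrow> real (bits x) \<le> 1 + log 2 x"
proof -
  assume x: "0 < x"
  then have "2 ^ floor_log x \<le> x" by (rule floor_log_exp2_le)
  then have "real (floor_log x) \<le> log 2 x"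
    using x by (subst le_log_iff) (auto simp: powr_realpow of_nat_power[symmetric] simp del: of_nat_power)
  then show ?thesis by (simp add: bits_def)
qed

text \<open>One logarithm comes from the number of trials and one from the bit lengths. The second
  does not involve \<epsilon>: as the accuracy is capped by \<open>n\<close>, all numbers are at
  most a constant times \<open>n ^ 6\<close>.\<close>

lemma total_time_le:
  fixes c :: nat
  obtains K :: real where "\<And>n q \<epsilon>. 0 < n \<Longrightarrow> 0 < \<epsilon> \<Longrightarrow> \<epsilon> \<le> 1 \<Longrightarrow> 0 < q \<Longrightarrow> q \<le> 2 / \<epsilon> \<Longrightarrow>
    total_time q n (min n q) (num_trials c n (min n q)) \<le> K * (1 + log 2 n) ^ 2 * n / \<epsilon> ^ 3"
proof -
  define A where "A = csize explore_body + 222"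
  define C where "C = 540 + Suc c * (14 * A + 20)"
  \<comment> \<open>The 8 is \<open>2 ^ 3\<close> from the cube of
    \<open>q \<le> 2 / \<epsilon>\<close>; in 7, six units come from the exponent of
    \<open>n ^ 6\<close> and one from the definition of \<open>bits\<close>; the final 4 absorbs
    \<open>2 * q\<close>.\<close>
  define K where "K = 8 * real C * (log 2 (24 * Suc c) + 7) + 4"
  have "total_time q n (min n q) (num_trials c n (min n q)) \<le> K * (1 + log 2 n) ^ 2 * n / \<epsilon> ^ 3"
    if n: "0 < n" and \<epsilon>: "0 < \<epsilon>" "\<epsilon> \<le> 1" and q: "0 < q" "q \<le> 2 / \<epsilon>" for n q :: nat and \<epsilon> :: real
  proof -
    define Q where "Q = min n q"
    define R where "R = num_trials c n Q"
    define L where "L = 1 + log 2 n"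
    have L1: "1 \<le> L" using n by (simp add: L_def)
    have Q: "0 < Q" "Q \<le> n" "Q \<le> q" using n q by (auto simp: Q_def)
    define S where "S = n * (Q * (Q * Q)) * bits n"
    have bn: "1 \<le> bits n" "bits n \<le> n" using bits_pos bits_le n by auto
    have S: "bits n \<le> S" "1 \<le> S"
    proof -
      have "0 < n * (Q * (Q * Q))" using n Q by simp
      then have "1 * bits n \<le> n * (Q * (Q * Q)) * bits n" by (intro mult_right_mono) auto
      then show "bits n \<le> S" by (simp add: S_def)
      then show "1 \<le> S" using bn by simp
    qed
    have RS: "Suc R * (n * Q) \<le> Suc c * S"
    proof -
      have "n * Q * 1 \<le> n * Q * (Q * Q * bits n)" using Q bn by (intro mult_left_mono) (auto simp: Suc_le_eq)
      then have "n * Q \<le> S" by (simp add: S_def ac_simps)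
      moreover have "R * (n * Q) = c * S" by (simp add: R_def num_trials_def S_def ac_simps)
      ultimately show ?thesis by simp
    qed
    have nQ: "n \<le> n * Q" "1 \<le> n * Q" using n Q by (auto simp: Suc_le_eq)
    have "trial_time n (12 * (n * Q)) + 20 \<le> (14 * A + 20) * (n * Q)"
    proof -
      have "n + 12 * (n * Q) + 1 \<le> 14 * (n * Q)" using nQ by linarith
      then have "A * (n + 12 * (n * Q) + 1) \<le> A * (14 * (n * Q))" by (rule mult_left_mono) simp
      moreover have "20 \<le> 20 * (n * Q)" using nQ by linarith
      moreover have "trial_time n (12 * (n * Q)) = A * (n + 12 * (n * Q) + 1)"
        by (simp only: trial_time_def A_def)
      moreover have "(14 * A + 20) * (n * Q) = A * (14 * (n * Q)) + 20 * (n * Q)"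
        by (simp add: distrib_right)
      ultimately show ?thesis by linarith
    qed
    then have "Suc R * (trial_time n (12 * (n * Q)) + 20) \<le> Suc R * ((14 * A + 20) * (n * Q))"
      by (rule mult_left_mono) simp
    also have "\<dots> = (14 * A + 20) * (Suc R * (n * Q))" by (simp only: ac_simps)
    also have "\<dots> \<le> (14 * A + 20) * (Suc c * S)" using RS by (rule mult_left_mono) simp
    finally have 1: "500 + 40 * bits n + Suc R * (trial_time n (12 * (n * Q)) + 20) \<le> C * S"
    proof -
      assume *: "Suc R * (trial_time n (12 * (n * Q)) + 20) \<le> (14 * A + 20) * (Suc c * S)"
      have "C * S = 540 * S + (14 * A + 20) * (Suc c * S)" by (simp add: C_def algebra_simps)
      with * S show ?thesis by linarith
    qed
    have 2: "real (bits (24 * (n * n * (Q * R)))) \<le> (log 2 (24 * Suc c) + 7) * L"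
    proof -
      have "R \<le> c * (n * n * n)"
        unfolding R_def num_trials_def using Q bn by (intro mult_le_mono) auto
      then have "24 * (n * n * (Q * R)) \<le> 24 * (n * n * (n * (c * (n * n * n))))"
        using Q by (intro mult_le_mono) auto
      also have "\<dots> \<le> 24 * Suc c * n ^ 6" by (simp add: power_numeral_reduce)
      finally have "real (bits (24 * (n * n * (Q * R)))) \<le> real (bits (24 * Suc c * n ^ 6))"
        using bits_mono of_nat_le_iff by blast
      also have "\<dots> \<le> 1 + log 2 (real (24 * Suc c * n ^ 6))"
        using n by (intro bits_le_log) simp
      also have "log 2 (real (24 * Suc c * n ^ 6)) = log 2 (24 * Suc c) + 6 * log 2 n"
        using n by (simp add: log_mult log_nat_power del: of_nat_Suc)
      also have "1 + (log 2 (24 * Suc c) + 6 * log 2 n) \<le> (log 2 (24 * Suc c) + 7) * L"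
      proof -
        have "0 \<le> log 2 (24 * Suc c)" by simp
        then have "log 2 (24 * Suc c) * 1 \<le> log 2 (24 * Suc c) * L" using L1 by (rule mult_left_mono[rotated])
        then show ?thesis using L1 by (simp add: L_def algebra_simps)
      qed
      finally show ?thesis .
    qed
    have 3: "real S \<le> 8 * (n * L / \<epsilon> ^ 3)"
    proof -
      have "real Q ^ 3 \<le> (2 / \<epsilon>) ^ 3" using Q q by (intro power_mono) auto
      then have "real n * real Q ^ 3 * bits n \<le> real n * (2 / \<epsilon>) ^ 3 * L"
        using bits_le_log[OF n] L1 \<epsilon> by (intro mult_mono) (auto simp: L_def)
      then show ?thesis by (simp add: S_def power3_eq_cube power_divide ac_simps)
    qed
    have 4: "2 * real q \<le> 4 * (L ^ 2 * n / \<epsilon> ^ 3)"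
    proof -
      have "\<epsilon> ^ 3 \<le> \<epsilon> ^ 1" using \<epsilon> by (intro power_decreasing) auto
      then have "2 / \<epsilon> \<le> 2 / \<epsilon> ^ 3" using \<epsilon> by (intro divide_left_mono) auto
      moreover have "1 * 1 \<le> L ^ 2 * n" using L1 n by (intro mult_mono one_le_power) auto
      then have "1 / \<epsilon> ^ 3 \<le> L ^ 2 * n / \<epsilon> ^ 3" using \<epsilon> by (intro divide_right_mono) auto
      moreover have "2 / \<epsilon> ^ 3 = 2 * (1 / \<epsilon> ^ 3)" by simp
      ultimately show ?thesis using q(2) by linarith
    qed
    have "real (total_time q n Q R) \<le> real (C * S * bits (24 * (n * n * (Q * R)))) + 2 * q"
    proof -
      have "total_time q n Q R \<le> C * S * bits (24 * (n * n * (Q * R))) + 2 * q"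
        unfolding total_time_def using 1 by (intro add_mono mult_right_mono) auto
      then show ?thesis by (metis (mono_tags) of_nat_add of_nat_le_iff of_nat_mult of_nat_numeral)
    qed
    also have "real (C * S * bits (24 * (n * n * (Q * R))))
        \<le> C * (8 * (n * L / \<epsilon> ^ 3)) * ((log 2 (24 * Suc c) + 7) * L)"
      unfolding of_nat_mult[of "C * S"] of_nat_mult[of C]
      using 2 3 \<epsilon> L1 by (intro mult_mono) auto
    also have "\<dots> = 8 * real C * (log 2 (24 * Suc c) + 7) * (L ^ 2 * n / \<epsilon> ^ 3)"
      by (simp add: power2_eq_square)
    finally have "real (total_time q n Q R)
        \<le> 8 * real C * (log 2 (24 * Suc c) + 7) * (L ^ 2 * n / \<epsilon> ^ 3) + 2 * q" by simp
    moreover have "K * (L ^ 2 * n / \<epsilon> ^ 3) =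
        8 * real C * (log 2 (24 * Suc c) + 7) * (L ^ 2 * n / \<epsilon> ^ 3) + 4 * (L ^ 2 * n / \<epsilon> ^ 3)"
      by (simp only: K_def distrib_right)
    ultimately have "real (total_time q n Q R) \<le> K * (L ^ 2 * n / \<epsilon> ^ 3)"
      using 4 by linarith
    then show ?thesis by (simp add: Q_def R_def L_def)
  qed
  then show thesis by (rule that)
qed

theorem theorem1p4:
  fixes k :: nat
  shows "\<exists>(K::real) (d::nat). \<forall>\<epsilon>::real. 0 < \<epsilon> \<and> \<epsilon> \<le> 1 \<longrightarrow>
    (\<exists>P::com. \<forall>(n::nat) (E::nat set set). 1 \<le> n \<and> simple_graph n E \<longrightarrow>
      (\<exists>l::nat.
        (\<forall>c \<in> set_pmf (steps E l (initial P n)).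
            halted c
          \<and> real (time_used c) \<le> K * (1 + log 2 (real n)) ^ d * real n / \<epsilon> ^ 3
          \<and> real (queries_used c) \<le> K * (1 + log 2 (real n)) ^ d * real n / \<epsilon> ^ 3)
      \<and> measure_pmf.prob (steps E l (initial P n))
          {c. approx_matching_size 2 (\<epsilon> * real n) E (real (matching_output c))
            \<and> approx_vertex_cover_size 2 (\<epsilon> * real n) n E (real (vertex_cover_output c))}
        \<ge> 1 - 1 / real n ^ k))"
proof -
  define c where "c = 8 * Suc k"
  obtain K :: real where K: "\<And>n q \<epsilon>. 0 < n \<Longrightarrow> 0 < \<epsilon> \<Longrightarrow> \<epsilon> \<le> 1 \<Longrightarrow> 0 < q \<Longrightarrow> q \<le> 2 / \<epsilon> \<Longrightarrow>
    total_time q n (min n q) (num_trials c n (min n q)) \<le> K * (1 + log 2 n) ^ 2 * n / \<epsilon> ^ 3"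
    using total_time_le[of c] by blast
  show ?thesis
  proof (rule exI[of _ K], rule exI[of _ 2], intro allI impI)
    fix \<epsilon> :: real
    assume \<epsilon>: "0 < \<epsilon> \<and> \<epsilon> \<le> 1"
    \<comment> \<open>The program may depend on \<epsilon> but can only contain natural constants.
      Rounding up at most doubles the reciprocal, as \<epsilon> is at most 1.\<close>
    define q where "q = nat \<lceil>1 / \<epsilon>\<rceil>"
    have q: "0 < q" "1 / \<epsilon> \<le> q" "q \<le> 2 / \<epsilon>"
    proof -
      have 1: "1 \<le> 1 / \<epsilon>" using \<epsilon> by simp
      show *: "1 / \<epsilon> \<le> q" unfolding q_def by (rule real_nat_ceiling_ge)
      from 1 * have "1 \<le> real q" by linarith
      then show "0 < q" by simp
      have "q \<le> 1 / \<epsilon> + 1" unfolding q_def using 1 by linarith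
      also have "\<dots> \<le> 2 / \<epsilon>" using 1 by simp
      finally show "q \<le> 2 / \<epsilon>" .
    qed
    show "\<exists>P. \<forall>n E. 1 \<le> n \<and> simple_graph n E \<longrightarrow>
      (\<exists>l. (\<forall>c \<in> set_pmf (steps E l (initial P n)). halted c
          \<and> real (time_used c) \<le> K * (1 + log 2 (real n)) ^ 2 * real n / \<epsilon> ^ 3
          \<and> real (queries_used c) \<le> K * (1 + log 2 (real n)) ^ 2 * real n / \<epsilon> ^ 3)
      \<and> measure_pmf.prob (steps E l (initial P n))
          {c. approx_matching_size 2 (\<epsilon> * real n) E (real (matching_output c))
            \<and> approx_vertex_cover_size 2 (\<epsilon> * real n) n E (real (vertex_cover_output c))}
        \<ge> 1 - 1 / real n ^ k)"
    proof (rule exI[of _ "program c q"], intro allI impI)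
      fix n :: nat and E :: "nat set set"
      assume nE: "1 \<le> n \<and> simple_graph n E"
      then have n: "0 < n" and g: "simple_graph n E" by auto
      define Q where "Q = min n q"
      define R where "R = num_trials c n Q"
      define p where "p = success n E (12 * (n * Q))"
      \<comment> \<open>Every trial has its own order, so the quantity estimated is the mean size of
        the matched set. The bounds valid for each order pass to the mean.\<close>
      define M where "M = real (hits_all n E) / fact n"
      let ?f = "\<lambda>x. (matching_estimate n Q R x, cover_estimate n Q R x)"
      let ?good = "\<lambda>a b. approx_matching_size 2 (\<epsilon> * real n) E (real a) \<and>
        approx_vertex_cover_size 2 (\<epsilon> * real n) n E (real b)"
      have Q: "0 < Q" "Q = n \<or> 1 \<le> \<epsilon> * Q"
        using n q \<epsilon> by (auto simp: Q_def min_def field_simps)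
      have R: "0 < R" using n Q bits_pos[of n] by (simp add: R_def num_trials_def c_def)
      have "reaches E (initial (program c q) n) (total_time q n Q R) (map_pmf ?f (binomial_pmf R p))"
        using program_reaches[OF n q(1), of c E] by (simp add: Q_def R_def p_def c_def)
      then obtain l where l: "\<forall>c'\<in>set_pmf (steps E l (initial (program c q) n)).
          halted c' \<and> time_used c' \<le> total_time q n Q R \<and> queries_used c' \<le> total_time q n Q R"
        and out: "map_pmf (\<lambda>c'. (matching_output c', vertex_cover_output c'))
          (steps E l (initial (program c q) n)) = map_pmf ?f (binomial_pmf R p)"
        unfolding reaches_def by blast
      have time: "total_time q n Q R \<le> K * (1 + log 2 n) ^ 2 * n / \<epsilon> ^ 3"
        using K[OF n, of \<epsilon> q] \<epsilon> q by (simp add: Q_def R_def)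
      have avg: "real a \<le> M" if "\<And>s. s permutes {..<n} \<Longrightarrow> a \<le> card (matched n E s n)" for a
      proof -
        have "card (perms n) * a \<le> hits_all n E"
          unfolding hits_all_def using that sum_bounded_below[of "perms n" a] by simp
        then have "real (fact n * a) \<le> real (hits_all n E)" unfolding card_perms of_nat_le_iff .
        then show ?thesis by (simp add: M_def field_simps)
      qed
      have avg': "M \<le> real a" if "\<And>s. s permutes {..<n} \<Longrightarrow> card (matched n E s n) \<le> a" for a
      proof -
        have "hits_all n E \<le> card (perms n) * a"
          unfolding hits_all_def using that sum_bounded_above[of "perms n" _ a] by simp
        then have "real (hits_all n E) \<le> real (fact n * a)" unfolding card_perms of_nat_le_iff .
        then show ?thesis by (simp add: M_def field_simps)
      qed
      have M: "max_matching_size E \<le> M" "M \<le> 2 * max_matching_size E"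
        "min_vertex_cover_size n E \<le> M" "M \<le> 2 * min_vertex_cover_size n E"
        using avg[OF card_matched_bounds(1)[OF g]] avg'[OF card_matched_bounds(2)[OF g]]
          avg[OF card_matched_bounds(3)[OF g]] avg'[OF card_matched_bounds(4)[OF g]] by auto
      have np: "n * p = real (hits n E (12 * (n * Q))) / fact n"
        using n by (simp add: p_def success_def)
      have p: "n * p \<le> M" "M \<le> n * p + n / (4 * Q)"
      proof -
        show "n * p \<le> M"
          unfolding np M_def using hits_le[of n E "12 * (n * Q)"] by (intro divide_right_mono) auto
        let ?b = "12 * (n * Q)"
        have "real (?b * hits_all n E) \<le> real (?b * hits n E ?b + 3 * (fact n * n * n))"
          using hits_ge[of ?b n E] by (simp only: of_nat_le_iff)
        \<comment> \<open>Origin of the step bound: 12 is 3 from the number of stacks times 4 from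
          the tolerated loss \<open>n / (4 * Q)\<close>.\<close>
        moreover have "3 * (fact n * real n * real n) = real ?b * (fact n * n / (4 * Q))"
          using Q by simp
        ultimately have "real ?b * hits_all n E \<le> real ?b * (hits n E ?b + fact n * n / (4 * Q))"
          by (simp add: distrib_left)
        then have "real (hits_all n E) \<le> hits n E ?b + fact n * n / (4 * Q)"
          using n Q by simp
        then have "M \<le> (hits n E ?b + fact n * n / (4 * Q)) / fact n"
          unfolding M_def by (rule divide_right_mono) simp
        then show "M \<le> n * p + n / (4 * Q)"
          unfolding np by (simp add: add_divide_distrib)
      qed
      have good: "?good (matching_estimate n Q R x) (cover_estimate n Q R x)"
        if "\<bar>x / R - p\<bar> < 1 / (4 * Q)" for x
        using estimates_correct[OF n Q(1) R _ M p that Q(2)] \<epsilon>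
        by (simp add: approx_matching_size_def approx_vertex_cover_size_def)
      have "measure_pmf.prob (steps E l (initial (program c q) n))
          {c. ?good (matching_output c) (vertex_cover_output c)} =
        measure_pmf.prob (map_pmf (\<lambda>c'. (matching_output c', vertex_cover_output c'))
          (steps E l (initial (program c q) n))) {(a, b). ?good a b}"
        by (simp add: measure_map_pmf vimage_def)
      also have "\<dots> = measure_pmf.prob (binomial_pmf R p) {x. ?good (fst (?f x)) (snd (?f x))}"
        unfolding out by (simp add: measure_map_pmf vimage_def)
      also have "\<dots> \<ge> measure_pmf.prob (binomial_pmf R p) (UNIV - {x. \<bar>x / R - p\<bar> \<ge> 1 / (4 * Q)})"
        using good by (intro measure_pmf.finite_measure_mono) auto
      also have "measure_pmf.prob (binomial_pmf R p) (UNIV - {x. \<bar>x / R - p\<bar> \<ge> 1 / (4 * Q)}) =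
          1 - measure_pmf.prob (binomial_pmf R p) {x. \<bar>x / R - p\<bar> \<ge> 1 / (4 * Q)}"
        using measure_pmf.prob_compl[of "{x. \<bar>x / R - p\<bar> \<ge> 1 / (4 * Q)}" "binomial_pmf R p"] by simp
      finally have prob: "1 - 1 / real n ^ k \<le> measure_pmf.prob (steps E l (initial (program c q) n))
          {c. ?good (matching_output c) (vertex_cover_output c)}"
        using sampling_error[OF n Q(1) trial_pmf_bernoulli(2)[OF n, of E "12 * (n * Q)"], of k]
        by (simp add: R_def c_def p_def)
      show "\<exists>l. (\<forall>c' \<in> set_pmf (steps E l (initial (program c q) n)). halted c'
          \<and> real (time_used c') \<le> K * (1 + log 2 (real n)) ^ 2 * real n / \<epsilon> ^ 3
          \<and> real (queries_used c') \<le> K * (1 + log 2 (real n)) ^ 2 * real n / \<epsilon> ^ 3)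
        \<and> measure_pmf.prob (steps E l (initial (program c q) n))
          {c. approx_matching_size 2 (\<epsilon> * real n) E (real (matching_output c))
            \<and> approx_vertex_cover_size 2 (\<epsilon> * real n) n E (real (vertex_cover_output c))}
        \<ge> 1 - 1 / real n ^ k"
      proof (intro exI[of _ l] conjI ballI prob)
        fix c'
        assume "c' \<in> set_pmf (steps E l (initial (program c q) n))"
        then have "halted c'" "real (time_used c') \<le> total_time q n Q R"
          "real (queries_used c') \<le> total_time q n Q R"
          using l by auto
        then show "halted c'" "real (time_used c') \<le> K * (1 + log 2 (real n)) ^ 2 * real n / \<epsilon> ^ 3"
          "real (queries_used c') \<le> K * (1 + log 2 (real n)) ^ 2 * real n / \<epsilon> ^ 3"
          using time by linarith+
      qed
    qed
  qed
qed

end
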